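(* Let $N\in\mathbb{Z}_+$ and let $w$ be a weight function on $\mathbb{Z}$ for which there exist $c_1>0$, $c_2>0$ and $\alpha\in(0,1)$ such that $$c_1(1+|m|^N)\le w(m)\le c_2(1+|m|^{N+\alpha})\quad\text{for all } m\in\mathbb{Z}.$$ For $0\le k\le N$ let $I_k=\{f\in L^1_w(\mathbb{Z}):\hat f^{(j)}(0)=0\text{ for }0\le j\le k\}$. Then $I_0,I_1,\dots,I_N$ are the only closed primary ideals of $L^1_w(\mathbb{Z})$ with cospectrum $\{\hat e\}$.
   Context: A weight function on $\mathbb{Z}$ is a function $w$ on $\mathbb{Z}$ with $w(m)\ge1$ and $w(m+n)\le w(m)w(n)$ for all $m,n\in\mathbb{Z}$. $L^1_w(\mathbb{Z})=\{f:\mathbb{Z}\to\mathbb{C}:\|f\|_{1,w}=\sum_{n}|f(n)|w(n)<\infty\}$, a Banach algebra under convolution and the norm $\|\cdot\|_{1,w}$. The dual group of $\mathbb{Z}$ is identified with $T=\mathbb{R}/2\pi\mathbb{Z}$, its unit $\hat e$ being the class of $0$; $\hat f(t)=\sum_n f(n)e^{-int}$ for $t\in T$. Under the hypothesis on $w$, $\hat f$ is $N$ times continuously differentiable on $T$ for every $f\in L^1_w(\mathbb{Z})$. A primary ideal is an ideal contained in exactly one maximal ideal. The cospectrum of an ideal $J$ of $L^1_w(\mathbb{Z})$ is $\{t\in T:\hat f(t)=0\text{ for all }f\in J\}$. $\mathbb{Z}_+$ denotes the non-negative integers. *)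

theory Defs
  imports "HOL-Analysis.Analysis" "HOL-Algebra.Ideal" "HOL-Library.Real_Mod"
begin

definition weight :: "(int \<Rightarrow> real) \<Rightarrow> bool" where
  "weight w \<longleftrightarrow> (\<forall>m. 1 \<le> w m) \<and> (\<forall>m n. w (m + n) \<le> w m * w n)"

section \<open>The Beurling algebra\<close>

definition L1w :: "(int \<Rightarrow> real) \<Rightarrow> (int \<Rightarrow> complex) set" where
  "L1w w = {f. (\<lambda>n. norm (f n) * w n) summable_on UNIV}"

definition L1w_norm :: "(int \<Rightarrow> real) \<Rightarrow> (int \<Rightarrow> complex) \<Rightarrow> real" where
  "L1w_norm w f = (\<Sum>\<^sub>\<infinity>n. norm (f n) * w n)"

definition convol :: "(int \<Rightarrow> complex) \<Rightarrow> (int \<Rightarrow> complex) \<Rightarrow> int \<Rightarrow> complex" where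
  "convol f g = (\<lambda>n. \<Sum>\<^sub>\<infinity>m. f m * g (n - m))"

text \<open>
  Scalars need no separate treatment: the algebra is unital, and \<open>c f\<close> is the convolution
  of \<open>c \<delta>\<^sub>0\<close> with \<open>f\<close>. Hence the ideals of this ring are exactly the ideals of the
  complex algebra, and likewise for maximal ideals.
\<close>

definition L1w_ring :: "(int \<Rightarrow> real) \<Rightarrow> (int \<Rightarrow> complex) ring" where
  "L1w_ring w =
    \<lparr>carrier = L1w w,
     mult = convol,
     one = (\<lambda>n. if n = 0 then 1 else 0),
     zero = (\<lambda>n. 0),
     add = (\<lambda>f g n. f n + g n)\<rparr>"

definition L1w_topology :: "(int \<Rightarrow> real) \<Rightarrow> (int \<Rightarrow> complex) topology" where
  "L1w_topology w = Metric_space.mtopology (L1w w) (\<lambda>f g. L1w_norm w (\<lambda>n. f n - g n))"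

text \<open>
  Primary in the sense of commutative Banach algebras, not of commutative algebra
  (where it is a condition on products and powers of elements).
\<close>

definition primary_ideal :: "'a set \<Rightarrow> ('a, 'b) ring_scheme \<Rightarrow> bool" where
  "primary_ideal J R \<longleftrightarrow> ideal J R \<and> (\<exists>!M. maximalideal M R \<and> J \<subseteq> M)"

section \<open>Fourier transform and cospectrum\<close>

text \<open>
  A point of \<open>T = \<real>/2\<pi>\<int>\<close> is a residue class of reals modulo \<open>2\<pi>\<close>. The Fourier
  transform is a \<open>2\<pi>\<close>-periodic function on the reals.
\<close>

definition circle_rel :: "(real \<times> real) set" where
  "circle_rel = {(s, t). [s = t] (rmod (2 * pi))}"

definition circle :: "real set set" where
  "circle = UNIV // circle_rel"

definition e_hat :: "real set" where
  "e_hat = circle_rel `` {0}"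

definition fourier :: "(int \<Rightarrow> complex) \<Rightarrow> real \<Rightarrow> complex" where
  "fourier f t = (\<Sum>\<^sub>\<infinity>n. f n * exp (- \<i> * of_int n * of_real t))"

definition cospectrum :: "(int \<Rightarrow> complex) set \<Rightarrow> real set set" where
  "cospectrum J = {x \<in> circle. \<forall>f\<in>J. \<forall>t\<in>x. fourier f t = 0}"

text \<open>
  The operator \<open>deriv\<close> does not apply to functions from the reals to the complex numbers.
\<close>

definition nth_derivative :: "nat \<Rightarrow> (real \<Rightarrow> complex) \<Rightarrow> real \<Rightarrow> complex" where
  "nth_derivative j = (\<lambda>h t. vector_derivative h (at t)) ^^ j"

definition I_ideal :: "(int \<Rightarrow> real) \<Rightarrow> nat \<Rightarrow> (int \<Rightarrow> complex) set" where
  "I_ideal w k = {f \<in> L1w w. \<forall>j\<le>k. nth_derivative j (fourier f) 0 = 0}"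

end

theory Submission
  imports Defs
begin

text \<open>
  Write \<open>x = \<delta>\<^sub>1 - \<delta>\<^sub>0\<close> and let \<open>E m\<close> be the set of \<open>f\<close> whose Fourier transform vanishes to order
  \<open>m\<close> at \<open>0\<close>, so that \<open>I\<^sub>k = E (k + 1)\<close>. Each \<open>f \<in> E m\<close> is a multiple of \<open>x\<^sup>m\<close> modulo \<open>E (m + 1)\<close>, and
  \<open>x\<^sup>m A\<close> is dense in \<open>E m\<close> for \<open>m \<le> N + 1\<close>. Hence a closed ideal inside \<open>E 1\<close> that contains \<open>x\<^sup>N\<^sup>+\<^sup>1\<close>
  is one of the \<open>E m\<close>.

  Let \<open>J\<close> be closed and primary with cospectrum \<open>{e}\<close>, so that \<open>E 1\<close> is the only maximal ideal above
  it. If the transform of \<open>h\<close> does not vanish at \<open>0\<close>, then \<open>J\<close> and \<open>h\<close> generate the unit ideal,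
  \<open>1 = j + u h\<close>; so \<open>f h = 0\<close> implies \<open>f = f j \<in> J\<close>. Taking for \<open>h\<close> a kernel with Fourier transform
  supported near \<open>0\<close>, it follows that \<open>J\<close> contains \<open>f = \<delta>\<^sub>0 - \<chi>\<^sub>L\<close>, where the transform of \<open>\<chi>\<^sub>L\<close> is the
  bump \<open>B (L t)\<close>. Finally \<open>x\<^sup>N\<^sup>+\<^sup>1 \<chi>\<^sub>L\<close> has norm \<open>O (L\<^bsup>N + \<alpha> - (N + 1)\<^esup>) \<rightarrow> 0\<close> since \<open>\<alpha> < 1\<close>,
  and \<open>x\<^sup>N\<^sup>+\<^sup>1 \<in> J\<close> because \<open>J\<close> is closed.
\<close>

section \<open>Absolutely summable sequences\<close>

text \<open>Two analytic facts carry the weight. The kernels must have finite weighted norm and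
  transforms that vanish off a neighbourhood of 0, which asks for quantitative smoothness: a bump of
  class C^K with \<open>K = N + 3\<close> gives decay \<open>(1 + |n| / L)^(-K)\<close> after
  \<open>K\<close> integrations by parts, the weight grows with degree
  \<open>N + \<alpha> < N + 1\<close>, and two powers remain for summation. Moreover the transform
  of the kernel must equal 1 exactly near 0; this is a pointwise Fourier inversion, obtained by
  telescoping. The two bounds on \<open>w\<close> do different work. The lower one turns the
  derivatives at 0 up to order \<open>N\<close>, written as moments \<open>\<Sum> n^j f(n)\<close>,
  into bounded functionals, so that the \<open>E m\<close> are closed. The upper one enters through
  the norm of the kernels. Each factor \<open>x\<close> gains \<open>1 / L\<close> against a cost of
  \<open>L^(N + \<alpha>)\<close>, and \<open>N + 1\<close> is the first exponent for which the gain
  wins.\<close>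

abbreviation l1 :: "(int \<Rightarrow> complex) \<Rightarrow> bool" where
  "l1 f \<equiv> (\<lambda>n. norm (f n)) summable_on UNIV"

lemma norm_fourier_term [simp]: "norm (exp (- \<i> * of_int n * of_real t)) = 1"
  by (simp add: norm_exp_eq_Re)

lemma fourier_summable:
  assumes "l1 f"
  shows "l1 (\<lambda>n. f n * exp (- \<i> * of_int n * of_real t))"
  using assms by (simp add: norm_mult)

lemma fourier_has_sum:
  assumes "l1 f"
  shows "((\<lambda>n. f n * exp (- \<i> * of_int n * of_real t)) has_sum fourier f t) UNIV"
  unfolding fourier_def using abs_summable_summable[OF fourier_summable[OF assms]] by (rule has_sum_infsum)

lemma continuous_on_fourier:
  assumes "l1 f"
  shows "continuous_on S (fourier f)"
proof (rule uniform_limit_theorem)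
  show "uniform_limit S (\<lambda>X t. \<Sum>n\<in>X. f n * exp (- \<i> * of_int n * of_real t)) (fourier f)
          (finite_subsets_at_top UNIV)"
    by (rule Weierstrass_m_test_general'[where M = "\<lambda>n. norm (f n)"])
       (use assms fourier_has_sum in \<open>auto simp: norm_mult\<close>)
  show "\<forall>\<^sub>F X in finite_subsets_at_top UNIV.
      continuous_on S (\<lambda>t. \<Sum>n\<in>X. f n * exp (- \<i> * of_int n * of_real t))"
    by (intro always_eventually allI continuous_intros)
qed auto

text \<open>The Fourier series converges uniformly by the M-test, so it can be integrated term by
  term against a continuous \<open>g\<close>. The scale \<open>r\<close> serves the kernels, whose
  integration variable is a dilation of \<open>t\<close>.\<close>

lemma integral_mult_fourier:
  fixes g :: "real \<Rightarrow> complex"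
  assumes f: "l1 f" and g: "continuous_on {a..b} g"
  shows "((\<lambda>m. f m * integral {a..b} (\<lambda>t. g t * exp (- \<i> * of_int m * of_real (r * t))))
           has_sum integral {a..b} (\<lambda>t. g t * fourier f (r * t))) UNIV"
proof -
  obtain C where C: "\<And>t. t \<in> {a..b} \<Longrightarrow> norm (g t) \<le> C"
    using compact_imp_bounded[OF compact_continuous_image[OF g compact_Icc]]
    unfolding bounded_iff by blast
  have u: "uniform_limit {a..b} (\<lambda>X t. \<Sum>m\<in>X. g t * (f m * exp (- \<i> * of_int m * of_real (r * t))))
          (\<lambda>t. g t * fourier f (r * t)) (finite_subsets_at_top UNIV)"
  proof (rule Weierstrass_m_test_general'[where M = "\<lambda>m. C * norm (f m)"])
    show "norm (g t * (f m * exp (- \<i> * of_int m * of_real (r * t)))) \<le> C * norm (f m)"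
      if "t \<in> {a..b}" for m t
      using mult_right_mono[OF C[OF that] norm_ge_zero[of "f m"]] by (simp add: norm_mult)
    show "((\<lambda>m. g t * (f m * exp (- \<i> * of_int m * of_real (r * t)))) has_sum
            g t * fourier f (r * t)) UNIV" for t
      by (intro has_sum_cmult_right fourier_has_sum f)
    show "(\<lambda>m. C * norm (f m)) summable_on UNIV"
      using f by (rule summable_on_cmult_right)
  qed
  have "continuous_on {a..b} (\<lambda>t. \<Sum>m\<in>X. g t * (f m * exp (- \<i> * of_int m * of_real (r * t))))" for X
    by (intro continuous_intros g)
  then obtain I J where I: "\<And>X. ((\<lambda>t. \<Sum>m\<in>X. g t * (f m * exp (- \<i> * of_int m * of_real (r * t))))
        has_integral I X) {a..b}"
      and J: "((\<lambda>t. g t * fourier f (r * t)) has_integral J) {a..b}"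
      and IJ: "(I \<longlongrightarrow> J) (finite_subsets_at_top UNIV)"
    using uniform_limit_integral[OF u] by auto
  have int: "(\<lambda>t. g t * exp (- \<i> * of_int m * of_real (r * t))) integrable_on {a..b}" for m
    by (intro integrable_continuous_interval continuous_intros g)
  have "((\<lambda>t. \<Sum>m\<in>X. g t * (f m * exp (- \<i> * of_int m * of_real (r * t)))) has_integral
      (\<Sum>m\<in>X. f m * integral {a..b} (\<lambda>t. g t * exp (- \<i> * of_int m * of_real (r * t))))) {a..b}"
    if "finite X" for X
    using has_integral_mult_right[OF integrable_integral[OF int]]
    by (intro has_integral_sum that) (simp add: mult_ac)
  then have "I X = (\<Sum>m\<in>X. f m * integral {a..b} (\<lambda>t. g t * exp (- \<i> * of_int m * of_real (r * t))))"
    if "finite X" for X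
    using I has_integral_unique that by blast
  then have "((\<lambda>X. \<Sum>m\<in>X. f m * integral {a..b} (\<lambda>t. g t * exp (- \<i> * of_int m * of_real (r * t)))) \<longlongrightarrow> J)
      (finite_subsets_at_top UNIV)"
    using IJ by (elim Lim_transform_eventually) (auto intro: eventually_finite_subsets_at_top_weakI)
  then show ?thesis
    unfolding has_sum_def using J by (simp add: integral_unique)
qed

lemma integral_exp_of_int:
  assumes "L > 0"
  shows "integral {- (pi * L)..pi * L} (\<lambda>x. exp (\<i> * of_int k * of_real (x / L))) =
      (if k = 0 then of_real (2 * pi * L) else 0)"
proof (cases "k = 0")
  case True
  then show ?thesis using assms by (simp add: scaleR_conv_of_real)
next
  case False
  let ?F = "\<lambda>x. exp (\<i> * of_int k * of_real (x / L)) * (of_real L / (\<i> * of_int k))"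
  have "((\<lambda>x. exp (\<i> * of_int k * of_real (x / L))) has_integral ?F (pi * L) - ?F (- (pi * L)))
      {- (pi * L)..pi * L}"
  proof (rule fundamental_theorem_of_calculus)
    show "- (pi * L) \<le> pi * L" using assms pi_gt_zero by (simp add: order.trans[of _ 0])
    show "(?F has_vector_derivative exp (\<i> * of_int k * of_real (x / L))) (at x within S)" for x S
      using assms False
      by (auto intro!: derivative_eq_intros has_vector_derivative_real_field simp: field_simps)
  qed
  moreover have "exp (\<i> * of_int k * of_real pi) = exp (\<i> * of_int k * of_real (- pi))"
    unfolding exp_eq by (intro exI[of _ k]) (simp add: algebra_simps)
  ultimately show ?thesis using assms False by (simp add: integral_unique)
qed

lemma fourier_coefficient:
  assumes "l1 f"
  shows "integral {-pi..pi} (\<lambda>t. exp (\<i> * of_int n * of_real t) * fourier f t) = of_real (2 * pi) * f n"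
proof -
  have "((\<lambda>m. f m * integral {-pi..pi} (\<lambda>t. exp (\<i> * of_int n * of_real t) *
           exp (- \<i> * of_int m * of_real (1 * t)))) has_sum
         integral {-pi..pi} (\<lambda>t. exp (\<i> * of_int n * of_real t) * fourier f (1 * t))) UNIV"
    by (intro integral_mult_fourier assms continuous_intros)
  moreover have "integral {-pi..pi} (\<lambda>t. exp (\<i> * of_int n * of_real t) *
           exp (- \<i> * of_int m * of_real (1 * t))) = (if m = n then of_real (2 * pi) else 0)" for m
    using integral_exp_of_int[of 1 "n - m"] by (simp add: exp_add[symmetric] algebra_simps)
  ultimately have "((\<lambda>m. if m = n then of_real (2 * pi) * f n else 0) has_sum
         integral {-pi..pi} (\<lambda>t. exp (\<i> * of_int n * of_real t) * fourier f t)) UNIV"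
    by (simp only: if_distrib[of "\<lambda>x. f _ * x"] mult_zero_right mult_1 cong: if_cong)
       (simp add: mult.commute cong: if_cong)
  moreover have "((\<lambda>m. if m = n then of_real (2 * pi) * f n else 0) has_sum of_real (2 * pi) * f n) UNIV"
    using has_sum_cong_neutral[of "{n}" UNIV "\<lambda>m. if m = n then of_real (2 * pi) * f n else 0"
        "\<lambda>m. if m = n then of_real (2 * pi) * f n else 0" "of_real (2 * pi) * f n"]
    by (auto simp: has_sum_finite_iff)
  ultimately show ?thesis by (rule has_sum_unique)
qed

text \<open>Orthogonality of the characters recovers every coefficient. Commutativity, associativity
  and distributivity of convolution are later read off the transforms through this
  injectivity.\<close>

lemma fourier_inject:
  assumes "l1 f" "l1 g" "\<And>t. fourier f t = fourier g t"
  shows "f = g"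
proof
  fix n
  have "of_real (2 * pi) * f n = of_real (2 * pi) * g n"
    using fourier_coefficient[OF assms(1), of n] fourier_coefficient[OF assms(2), of n] assms(3) by simp
  then show "f n = g n" by simp
qed

text \<open>Integrating the formally differentiated series term by term over
  \<open>[t - 1, y]\<close> gives back \<open>fourier f y - fourier f (t - 1)\<close>, and the
  fundamental theorem of calculus differentiates it. The base point \<open>t - 1\<close> keeps
  \<open>t\<close> in the interior of the interval.\<close>

lemma fourier_has_vector_derivative:
  assumes f: "l1 f" and g: "l1 (\<lambda>n. - \<i> * of_int n * f n)"
  shows "(fourier f has_vector_derivative fourier (\<lambda>n. - \<i> * of_int n * f n) t) (at t)"
proof -
  let ?g = "\<lambda>n. - \<i> * of_int n * f n"
  have eq: "fourier f y = fourier f (t - 1) + integral {t - 1..y} (fourier ?g)" if "y \<in> {t - 1..t + 1}" for y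
  proof -
    have y: "t - 1 \<le> y" using that by simp
    have "((\<lambda>m. ?g m * integral {t - 1..y} (\<lambda>t. 1 * exp (- \<i> * of_int m * of_real (1 * t)))) has_sum
         integral {t - 1..y} (\<lambda>t. 1 * fourier ?g (1 * t))) UNIV"
      by (intro integral_mult_fourier g continuous_intros)
    moreover have "?g m * integral {t - 1..y} (\<lambda>t. 1 * exp (- \<i> * of_int m * of_real (1 * t))) =
        f m * exp (- \<i> * of_int m * of_real y) - f m * exp (- \<i> * of_int m * of_real (t - 1))" for m
    proof -
      have "((\<lambda>t. ?g m * exp (- \<i> * of_int m * of_real t)) has_integral
          f m * exp (- \<i> * of_int m * of_real y) - f m * exp (- \<i> * of_int m * of_real (t - 1))) {t - 1..y}"
        by (intro fundamental_theorem_of_calculus y)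
           (auto intro!: derivative_eq_intros has_vector_derivative_real_field simp: mult_ac)
      from integral_unique[OF this] show ?thesis by (simp only: integral_mult_right mult_1)
    qed
    ultimately have "((\<lambda>m. f m * exp (- \<i> * of_int m * of_real y) - f m * exp (- \<i> * of_int m * of_real (t - 1)))
        has_sum integral {t - 1..y} (fourier ?g)) UNIV"
      by simp
    moreover have "((\<lambda>m. f m * exp (- \<i> * of_int m * of_real y) - f m * exp (- \<i> * of_int m * of_real (t - 1)))
        has_sum (fourier f y - fourier f (t - 1))) UNIV"
      using has_sum_add[OF fourier_has_sum[OF f, of y] has_sum_cmult_right[OF fourier_has_sum[OF f, of "t - 1"], of "-1"]]
      by simp
    ultimately show ?thesis using has_sum_unique by fastforce
  qed
  have "((\<lambda>y. fourier f (t - 1) + integral {t - 1..y} (fourier ?g)) has_vector_derivative fourier ?g t)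
      (at t within {t - 1..t + 1})"
    using integral_has_vector_derivative[OF continuous_on_fourier[OF g], of t "t - 1" "t + 1"]
    by (auto intro!: derivative_eq_intros)
  then have "(fourier f has_vector_derivative fourier ?g t) (at t within {t - 1..t + 1})"
    by (rule has_vector_derivative_transform[where g = "fourier f", rotated 2]) (simp, rule eq)
  then show ?thesis
    by (simp add: at_within_Icc_at)
qed

section \<open>Convolution\<close>

text \<open>Tonelli for nonnegative families. Joint summability justifies exchanging the sums in
  \<open>fourier_convol\<close>, the value of the double sum yields submultiplicativity of the norm,
  and summability of the slices makes convolution well defined.\<close>

lemma summable_shifted_product:
  fixes a b :: "int \<Rightarrow> real"
  assumes a: "a summable_on UNIV" "\<And>n. 0 \<le> a n" and b: "b summable_on UNIV" "\<And>n. 0 \<le> b n"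
  shows "(\<lambda>(n, m). a m * b (n - m)) summable_on UNIV \<times> UNIV"
    and "(\<Sum>\<^sub>\<infinity>n. \<Sum>\<^sub>\<infinity>m. a m * b (n - m)) = infsum a UNIV * infsum b UNIV"
    and "(\<lambda>m. a m * b (n - m)) summable_on UNIV"
proof -
  have bij: "bij_betw (\<lambda>n::int. n - m) UNIV UNIV" for m
    by (rule bij_betw_byWitness[where f' = "\<lambda>n. n + m"]) auto
  have hb: "((\<lambda>n. a m * b (n - m)) has_sum a m * infsum b UNIV) UNIV" for m
    using b by (intro has_sum_cmult_right) (simp add: has_sum_reindex_bij_betw[OF bij, of b])
  have "Infinite_Sum.abs_summable_on (\<lambda>(m, n). a m * b (n - m)) (UNIV \<times> UNIV)"
    unfolding Infinite_Sum.abs_summable_on_Sigma_iff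
  proof (intro conjI ballI)
    show "Infinite_Sum.abs_summable_on (\<lambda>n. case (m, n) of (m, n) \<Rightarrow> a m * b (n - m)) (UNIV)" for m
      using has_sum_imp_summable[OF hb] a b by (simp add: abs_mult)
    have "(\<Sum>\<^sub>\<infinity>n. norm (a m * b (n - m))) = a m * infsum b UNIV" for m
      using infsumI[OF hb] a b by (simp add: abs_mult)
    then show "Infinite_Sum.abs_summable_on (\<lambda>m. \<Sum>\<^sub>\<infinity>n. norm (case (m, n) of (m, n) \<Rightarrow> a m * b (n - m))) (UNIV)"
      using summable_on_cmult_left[OF a(1)] a b by (simp add: abs_mult infsum_nonneg)
  qed
  then have s: "(\<lambda>(m, n). a m * b (n - m)) summable_on UNIV \<times> UNIV"
    by (rule abs_summable_summable)
  have "(\<lambda>(n, m). a m * b (n - m)) = (\<lambda>(m, n). a m * b (n - m)) \<circ> prod.swap"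
    by auto
  then show s': "(\<lambda>(n, m). a m * b (n - m)) summable_on UNIV \<times> UNIV"
    using summable_on_reindex[of prod.swap "UNIV \<times> UNIV" "\<lambda>(m, n). a m * b (n - m)"] s by simp
  have "Infinite_Sum.abs_summable_on (\<lambda>(n, m). a m * b (n - m)) (UNIV \<times> UNIV)"
    using s' by (simp only: summable_on_iff_abs_summable_on_real[symmetric])
  then have "Infinite_Sum.abs_summable_on (\<lambda>m. a m * b (n - m)) UNIV"
    unfolding Infinite_Sum.abs_summable_on_Sigma_iff by simp
  then show "(\<lambda>m. a m * b (n - m)) summable_on UNIV" by (rule abs_summable_summable)
  have "(\<Sum>\<^sub>\<infinity>n. \<Sum>\<^sub>\<infinity>m. a m * b (n - m)) = (\<Sum>\<^sub>\<infinity>m. \<Sum>\<^sub>\<infinity>n. a m * b (n - m))"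
    by (rule infsum_swap_banach[OF s'])
  also have "\<dots> = (\<Sum>\<^sub>\<infinity>m. a m * infsum b UNIV)"
    using infsumI[OF hb] by simp
  also have "\<dots> = infsum a UNIV * infsum b UNIV"
    by (rule infsum_cmult_left) (use a in auto)
  finally show "(\<Sum>\<^sub>\<infinity>n. \<Sum>\<^sub>\<infinity>m. a m * b (n - m)) = infsum a UNIV * infsum b UNIV" .
qed

lemma convol_summable:
  assumes "l1 f" "l1 g"
  shows "(\<lambda>m. f m * g (n - m)) summable_on UNIV"
proof -
  have "(\<lambda>m. norm (f m) * norm (g (n - m))) summable_on UNIV"
    by (rule summable_shifted_product) (use assms in auto)
  then show ?thesis
    using abs_summable_summable[of "\<lambda>m. f m * g (n - m)"] by (simp add: norm_mult)
qed

lemma fourier_convol: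
  assumes f: "l1 f" and g: "l1 g"
  shows "fourier (convol f g) t = fourier f t * fourier g t"
proof -
  define e where "e = (\<lambda>n::int. exp (- \<i> * of_int n * of_real t))"
  have e: "e n = e m * e (n - m)" for n m
    by (simp add: e_def exp_add[symmetric] algebra_simps)
  have "(\<lambda>(n, m). norm (f m) * norm (g (n - m))) summable_on UNIV \<times> UNIV"
    by (rule summable_shifted_product) (use f g in auto)
  then have "Infinite_Sum.abs_summable_on (\<lambda>(n, m). f m * e m * (g (n - m) * e (n - m))) (UNIV \<times> UNIV)"
    by (simp add: case_prod_unfold norm_mult e_def)
  then have s: "(\<lambda>(n, m). f m * e m * (g (n - m) * e (n - m))) summable_on UNIV \<times> UNIV"
    by (rule abs_summable_summable)
  have bij: "bij_betw (\<lambda>n::int. n - m) UNIV UNIV" for m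
    by (rule bij_betw_byWitness[where f' = "\<lambda>n. n + m"]) auto
  have "fourier (convol f g) t = (\<Sum>\<^sub>\<infinity>n. (\<Sum>\<^sub>\<infinity>m. f m * g (n - m)) * e n)"
    by (simp add: fourier_def convol_def e_def)
  also have "\<dots> = (\<Sum>\<^sub>\<infinity>n. \<Sum>\<^sub>\<infinity>m. f m * e m * (g (n - m) * e (n - m)))"
  proof (rule infsum_cong)
    fix n
    have "(\<Sum>\<^sub>\<infinity>m. f m * g (n - m)) * e n = (\<Sum>\<^sub>\<infinity>m. f m * g (n - m) * e n)"
      using convol_summable[OF f g] by (intro infsum_cmult_left[symmetric]) auto
    also have "\<dots> = (\<Sum>\<^sub>\<infinity>m. f m * e m * (g (n - m) * e (n - m)))"
      by (intro infsum_cong) (simp add: e[of n] mult_ac)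
    finally show "(\<Sum>\<^sub>\<infinity>m. f m * g (n - m)) * e n = (\<Sum>\<^sub>\<infinity>m. f m * e m * (g (n - m) * e (n - m)))" .
  qed
  also have "\<dots> = (\<Sum>\<^sub>\<infinity>m. \<Sum>\<^sub>\<infinity>n. f m * e m * (g (n - m) * e (n - m)))"
    by (rule infsum_swap_banach[OF s])
  also have "\<dots> = (\<Sum>\<^sub>\<infinity>m. f m * e m * fourier g t)"
  proof (rule infsum_cong)
    fix m
    have "((\<lambda>n. g (n - m) * e (n - m)) has_sum fourier g t) UNIV"
      using fourier_has_sum[OF g, of t] has_sum_reindex_bij_betw[OF bij, of "\<lambda>n. g n * e n"]
      by (simp add: e_def)
    then show "(\<Sum>\<^sub>\<infinity>n. f m * e m * (g (n - m) * e (n - m))) = f m * e m * fourier g t"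
      by (intro infsumI has_sum_cmult_right)
  qed
  also have "\<dots> = fourier f t * fourier g t"
    using has_sum_cmult_left[OF fourier_has_sum[OF f, of t]] by (intro infsumI) (simp add: e_def)
  finally show ?thesis .
qed

section \<open>The Beurling algebra as a ring\<close>

text \<open>Krull's theorem by Zorn. Properness is phrased through \<open>\<one>\<close> because
  that survives unions of chains; any two elements of such a union lie in one member of the chain,
  so the union is again an ideal.\<close>

lemma (in cring) exists_maximalideal:
  assumes I: "ideal I R" and one: "\<one> \<notin> I"
  shows "\<exists>M. maximalideal M R \<and> I \<subseteq> M"
proof -
  define \<A> where "\<A> = {J. ideal J R \<and> I \<subseteq> J \<and> \<one> \<notin> J}"
  have union: "\<Union>\<C> \<in> \<A>" if ne: "\<C> \<noteq> {}" and ch: "subset.chain \<A> \<C>" for \<C>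
  proof -
    have \<C>: "ideal J R" "I \<subseteq> J" "\<one> \<notin> J" if "J \<in> \<C>" for J
      using ch that by (auto simp: subset.chain_def \<A>_def)
    have both: "\<exists>J\<in>\<C>. a \<in> J \<and> b \<in> J" if ab: "a \<in> \<Union>\<C>" "b \<in> \<Union>\<C>" for a b
    proof -
      from ab obtain J1 J2 where J: "J1 \<in> \<C>" "a \<in> J1" "J2 \<in> \<C>" "b \<in> J2" by blast
      have "J1 \<subseteq> J2 \<or> J2 \<subseteq> J1" using ch J by (auto simp: subset.chain_def)
      then show ?thesis using J by blast
    qed
    have "ideal (\<Union>\<C>) R"
    proof (rule idealI[OF ring_axioms])
      show "subgroup (\<Union>\<C>) (add_monoid R)"
      proof (rule subgroup.intro)
        show "\<Union>\<C> \<subseteq> carrier (add_monoid R)"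
          using ideal.Icarr[OF \<C>(1)] by auto
        show "x \<otimes>\<^bsub>add_monoid R\<^esub> y \<in> \<Union>\<C>" if xy: "x \<in> \<Union>\<C>" "y \<in> \<Union>\<C>" for x y
        proof -
          obtain J where "J \<in> \<C>" "x \<in> J" "y \<in> J" using both[OF xy] by blast
          then show ?thesis
            using additive_subgroup.a_closed[OF ideal.axioms(1)[OF \<C>(1)], of J x y] by auto
        qed
        show "\<one>\<^bsub>add_monoid R\<^esub> \<in> \<Union>\<C>"
        proof -
          obtain J where "J \<in> \<C>" using ne by blast
          then show ?thesis
            using additive_subgroup.zero_closed[OF ideal.axioms(1)[OF \<C>(1)], of J] by auto
        qed
        show "inv\<^bsub>add_monoid R\<^esub> x \<in> \<Union>\<C>" if "x \<in> \<Union>\<C>" for x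
        proof -
          obtain J where "J \<in> \<C>" "x \<in> J" using \<open>x \<in> \<Union>\<C>\<close> by blast
          then show ?thesis
            using additive_subgroup.a_inv_closed[OF ideal.axioms(1)[OF \<C>(1)], of J x] by (auto simp: a_inv_def)
        qed
      qed
      show "x \<otimes> a \<in> \<Union>\<C>" "a \<otimes> x \<in> \<Union>\<C>" if "a \<in> \<Union>\<C>" "x \<in> carrier R" for a x
        using that ideal.I_l_closed[OF \<C>(1)] ideal.I_r_closed[OF \<C>(1)] by blast+
    qed
    moreover obtain J where "J \<in> \<C>" using ne by blast
    ultimately show ?thesis using \<C> by (auto simp: \<A>_def)
  qed
  have "I \<in> \<A>" using I one by (simp add: \<A>_def)
  then obtain M where M: "M \<in> \<A>" and max: "\<And>J. J \<in> \<A> \<Longrightarrow> M \<subseteq> J \<Longrightarrow> J = M"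
    using subset_Zorn_nonempty[of \<A>] union by blast
  have "maximalideal M R"
  proof (rule maximalidealI)
    show "ideal M R" using M by (simp add: \<A>_def)
    show "carrier R \<noteq> M" using M by (auto simp: \<A>_def)
    fix J assume J: "ideal J R" "M \<subseteq> J" "J \<subseteq> carrier R"
    then show "J = M \<or> J = carrier R"
      using max[of J] M ideal.one_imp_carrier[OF J(1)] by (auto simp: \<A>_def)
  qed
  then show ?thesis using M by (auto simp: \<A>_def)
qed

lemma fourier_add:
  "l1 f \<Longrightarrow> l1 g \<Longrightarrow> fourier (\<lambda>n. f n + g n) t = fourier f t + fourier g t"
  unfolding fourier_def[of "\<lambda>n. f n + g n"] distrib_right
  by (intro infsumI has_sum_add fourier_has_sum)

lemma fourier_scale:
  "l1 f \<Longrightarrow> fourier (\<lambda>n. c * f n) t = c * fourier f t"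
  unfolding fourier_def[of "\<lambda>n. c * f n"] mult.assoc[of c]
  by (intro infsumI has_sum_cmult_right fourier_has_sum)

definition delta :: "int \<Rightarrow> int \<Rightarrow> complex" where
  "delta k = (\<lambda>n. if n = k then 1 else 0)"

text \<open>Its transform has a simple zero at the class of 0 and vanishes nowhere else on the
  circle, so its powers measure the order of vanishing at 0.\<close>

definition delta_diff :: "int \<Rightarrow> complex" where
  "delta_diff = (\<lambda>n. delta 1 n - delta 0 n)"

lemma convol_delta_diff: "convol delta_diff f n = f (n - 1) - f n"
proof -
  have "convol delta_diff f n = (\<Sum>\<^sub>\<infinity>m\<in>{0, 1}. delta_diff m * f (n - m))"
    unfolding convol_def by (rule infsum_cong_neutral) (auto simp: delta_diff_def delta_def)
  then show ?thesis by (simp add: delta_diff_def delta_def)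
qed

lemma fourier_delta: "fourier (delta k) t = exp (- \<i> * of_int k * of_real t)"
proof -
  have "fourier (delta k) t = (\<Sum>\<^sub>\<infinity>n\<in>{k}. delta k n * exp (- \<i> * of_int n * of_real t))"
    unfolding fourier_def by (rule infsum_cong_neutral) (auto simp: delta_def)
  then show ?thesis by (simp add: delta_def)
qed

lemma convol_delta: "convol (\<lambda>n. c * delta k n) f = (\<lambda>n. c * f (n - k))"
proof
  fix n
  have "convol (\<lambda>n. c * delta k n) f n = (\<Sum>\<^sub>\<infinity>m\<in>{k}. c * delta k m * f (n - m))"
    unfolding convol_def by (rule infsum_cong_neutral) (auto simp: delta_def)
  then show "convol (\<lambda>n. c * delta k n) f n = c * f (n - k)" by (simp add: delta_def)
qed

locale beurling =
  fixes w :: "int \<Rightarrow> real"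
  assumes weight: "weight w"
begin

abbreviation A :: "(int \<Rightarrow> complex) set" where "A \<equiv> L1w w"
abbreviation nrm :: "(int \<Rightarrow> complex) \<Rightarrow> real" where "nrm \<equiv> L1w_norm w"
abbreviation R :: "(int \<Rightarrow> complex) ring" where "R \<equiv> L1w_ring w"

lemma w_ge_1: "1 \<le> w n" and w_add_le: "w (m + n) \<le> w m * w n"
  using weight by (auto simp: weight_def)

lemma w_nonneg: "0 \<le> w n"
  using w_ge_1[of n] by linarith

lemma L1w_summable: "f \<in> A \<Longrightarrow> (\<lambda>n. norm (f n) * w n) summable_on UNIV"
  by (simp add: L1w_def)

lemma L1w_l1: "f \<in> A \<Longrightarrow> l1 f"
  by (rule summable_on_comparison_test[OF L1w_summable]) (use mult_left_mono[OF w_ge_1] in auto)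

lemma nrm_nonneg: "0 \<le> nrm f"
  unfolding L1w_norm_def by (intro infsum_nonneg) (simp add: w_nonneg)

lemma norm_le_nrm: "f \<in> A \<Longrightarrow> norm (f n) \<le> nrm f"
  using finite_sum_le_infsum[OF L1w_summable, of f "{n}"] mult_left_mono[OF w_ge_1[of n] norm_ge_zero[of "f n"]]
  by (simp add: L1w_norm_def w_nonneg)

lemma L1w_add:
  assumes "f \<in> A" "g \<in> A"
  shows "(\<lambda>n. f n + g n) \<in> A" "nrm (\<lambda>n. f n + g n) \<le> nrm f + nrm g"
proof -
  have le: "norm (f n + g n) * w n \<le> norm (f n) * w n + norm (g n) * w n" for n
    using mult_right_mono[OF norm_triangle_ineq w_nonneg] by (simp add: distrib_right)
  have s: "(\<lambda>n. norm (f n) * w n + norm (g n) * w n) summable_on UNIV"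
    by (intro summable_on_add L1w_summable assms)
  show 1: "(\<lambda>n. f n + g n) \<in> A"
    unfolding L1w_def mem_Collect_eq by (rule summable_on_comparison_test[OF s]) (use le w_nonneg in auto)
  have "nrm (\<lambda>n. f n + g n) \<le> (\<Sum>\<^sub>\<infinity>n. norm (f n) * w n + norm (g n) * w n)"
    unfolding L1w_norm_def by (rule infsum_mono[OF L1w_summable[OF 1] s le])
  also have "\<dots> = nrm f + nrm g"
    unfolding L1w_norm_def by (intro infsum_add L1w_summable assms)
  finally show "nrm (\<lambda>n. f n + g n) \<le> nrm f + nrm g" .
qed

lemma L1w_scale:
  assumes "f \<in> A"
  shows "(\<lambda>n. c * f n) \<in> A" "nrm (\<lambda>n. c * f n) = norm c * nrm f"
proof -
  have "(\<lambda>n. norm c * (norm (f n) * w n)) summable_on UNIV"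
    by (intro summable_on_cmult_right L1w_summable assms)
  then show "(\<lambda>n. c * f n) \<in> A" by (simp add: L1w_def norm_mult mult.assoc)
  show "nrm (\<lambda>n. c * f n) = norm c * nrm f"
    unfolding L1w_norm_def norm_mult mult.assoc by (intro infsum_cmult_right L1w_summable assms)
qed

lemma L1w_diff:
  assumes "f \<in> A" "g \<in> A"
  shows "(\<lambda>n. f n - g n) \<in> A" "nrm (\<lambda>n. f n - g n) \<le> nrm f + nrm g"
  using L1w_add[OF assms(1) L1w_scale(1)[OF assms(2), of "-1"]] L1w_scale(2)[OF assms(2), of "-1"] by auto

lemma nrm_triangle:
  assumes "f \<in> A" "g \<in> A" "h \<in> A"
  shows "nrm (\<lambda>n. f n - h n) \<le> nrm (\<lambda>n. f n - g n) + nrm (\<lambda>n. g n - h n)"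
  using L1w_add(2)[OF L1w_diff(1)[OF assms(1,2)] L1w_diff(1)[OF assms(2,3)]] by simp

lemma nrm_zero: "nrm (\<lambda>_. 0) = 0"
  by (simp add: L1w_norm_def)

lemma L1w_zero: "(\<lambda>_. 0) \<in> A"
  by (simp add: L1w_def)

lemma L1w_delta: "delta k \<in> A" "nrm (delta k) = w k"
proof -
  have "((\<lambda>n. norm (delta k n) * w n) has_sum w k) {k}"
    by (rule has_sum_finiteI) (auto simp: delta_def)
  then have "((\<lambda>n. norm (delta k n) * w n) has_sum w k) UNIV"
    by (subst has_sum_cong_neutral[where T = UNIV and S = "{k}" and g = "\<lambda>n. norm (delta k n) * w n", symmetric]) (auto simp: delta_def)
  then show "delta k \<in> A" "nrm (delta k) = w k"
    by (auto simp: L1w_def L1w_norm_def intro: has_sum_imp_summable infsumI)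
qed

text \<open>Since \<open>w n \<le> w m * w (n - m)\<close>, the weighted convolution is dominated
  pointwise by the convolution of the weighted absolute values, whose total mass is the product of
  the norms.\<close>

lemma L1w_convol:
  assumes "f \<in> A" "g \<in> A"
  shows "convol f g \<in> A" "nrm (convol f g) \<le> nrm f * nrm g"
proof -
  define a where "a = (\<lambda>n. norm (f n) * w n)"
  define b where "b = (\<lambda>n. norm (g n) * w n)"
  have ab: "a summable_on UNIV" "\<And>n. 0 \<le> a n" "b summable_on UNIV" "\<And>n. 0 \<le> b n"
    using assms by (auto simp: a_def b_def w_nonneg L1w_summable)
  note sp = summable_shifted_product[OF ab]
  have s: "(\<lambda>m. a m * b (n - m)) summable_on UNIV" for n
    by (rule sp(3))
  have le: "norm (convol f g n) * w n \<le> (\<Sum>\<^sub>\<infinity>m. a m * b (n - m))" for n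
  proof -
    have t: "norm (f m * g (n - m)) * w n \<le> a m * b (n - m)" for m
      using mult_left_mono[OF w_add_le[of m "n - m"], of "norm (f m * g (n - m))"]
      by (simp add: a_def b_def norm_mult mult_ac)
    have s1: "(\<lambda>m. norm (f m * g (n - m)) * w n) summable_on UNIV"
      by (rule summable_on_comparison_test[OF s]) (use t w_nonneg in auto)
    have s2: "(\<lambda>m. norm (f m * g (n - m))) summable_on UNIV"
      by (rule summable_on_comparison_test[OF s1]) (use mult_left_mono[OF w_ge_1] in auto)
    have "norm (convol f g n) * w n \<le> (\<Sum>\<^sub>\<infinity>m. norm (f m * g (n - m))) * w n"
      unfolding convol_def by (intro mult_right_mono norm_infsum_bound s2 w_nonneg)
    also have "\<dots> = (\<Sum>\<^sub>\<infinity>m. norm (f m * g (n - m)) * w n)"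
      by (intro infsum_cmult_left[symmetric] s2)
    also have "\<dots> \<le> (\<Sum>\<^sub>\<infinity>m. a m * b (n - m))"
      by (rule infsum_mono[OF s1 s t])
    finally show ?thesis .
  qed
  have s': "(\<lambda>n. \<Sum>\<^sub>\<infinity>m. a m * b (n - m)) summable_on UNIV"
    using sp(1) by (rule summable_on_Sigma_banach)
  show 1: "convol f g \<in> A"
    unfolding L1w_def mem_Collect_eq by (rule summable_on_comparison_test[OF s']) (use le w_nonneg in auto)
  have "nrm (convol f g) \<le> (\<Sum>\<^sub>\<infinity>n. \<Sum>\<^sub>\<infinity>m. a m * b (n - m))"
    unfolding L1w_norm_def by (rule infsum_mono[OF L1w_summable[OF 1] s' le])
  then show "nrm (convol f g) \<le> nrm f * nrm g"
    using sp(2) by (simp add: a_def b_def L1w_norm_def)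
qed

lemma L1w_eqI:
  assumes "f \<in> A" "g \<in> A" "\<And>t. fourier f t = fourier g t"
  shows "f = g"
  using assms fourier_inject L1w_l1 by blast

lemma fourier_convol_L1w:
  "f \<in> A \<Longrightarrow> g \<in> A \<Longrightarrow> fourier (convol f g) t = fourier f t * fourier g t"
  by (intro fourier_convol L1w_l1)

lemma fourier_add_L1w:
  "f \<in> A \<Longrightarrow> g \<in> A \<Longrightarrow> fourier (\<lambda>n. f n + g n) t = fourier f t + fourier g t"
  by (intro fourier_add L1w_l1)

lemma fourier_diff_L1w:
  "f \<in> A \<Longrightarrow> g \<in> A \<Longrightarrow> fourier (\<lambda>n. f n - g n) t = fourier f t - fourier g t"
  using fourier_add_L1w[of f "\<lambda>n. -1 * g n"] L1w_scale[of g "-1"] fourier_scale[OF L1w_l1, of g "-1"] by simp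

lemma convol_commute: "f \<in> A \<Longrightarrow> g \<in> A \<Longrightarrow> convol f g = convol g f"
  by (rule L1w_eqI) (auto simp: L1w_convol fourier_convol_L1w)

lemma convol_assoc:
  "f \<in> A \<Longrightarrow> g \<in> A \<Longrightarrow> h \<in> A \<Longrightarrow> convol (convol f g) h = convol f (convol g h)"
  by (rule L1w_eqI) (auto simp: L1w_convol fourier_convol_L1w)

lemma convol_add_left:
  "f \<in> A \<Longrightarrow> g \<in> A \<Longrightarrow> h \<in> A \<Longrightarrow> convol (\<lambda>n. f n + g n) h = (\<lambda>n. convol f h n + convol g h n)"
  by (rule L1w_eqI) (auto simp: L1w_convol L1w_add fourier_convol_L1w fourier_add_L1w distrib_right)

lemma convol_delta_0: "convol (delta 0) f = f"
  using convol_delta[of 1 0 f] by simp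

lemma ring_simps:
  "carrier R = A" "mult R = convol" "one R = delta 0" "zero R = (\<lambda>_. 0)" "add R = (\<lambda>f g n. f n + g n)"
  by (simp_all add: L1w_ring_def delta_def)

lemma L1w_cring: "cring R"
proof (rule cringI)
  show "abelian_group R"
  proof (rule abelian_groupI)
    fix f g h assume "f \<in> carrier R" "g \<in> carrier R" "h \<in> carrier R"
    then show "f \<oplus>\<^bsub>R\<^esub> g \<oplus>\<^bsub>R\<^esub> h = f \<oplus>\<^bsub>R\<^esub> (g \<oplus>\<^bsub>R\<^esub> h)"
      by (simp add: ring_simps add.assoc)
  next
    fix f g assume fg: "f \<in> carrier R" "g \<in> carrier R"
    then show "f \<oplus>\<^bsub>R\<^esub> g \<in> carrier R" by (simp add: ring_simps L1w_add)
    show "f \<oplus>\<^bsub>R\<^esub> g = g \<oplus>\<^bsub>R\<^esub> f" by (simp add: ring_simps add.commute)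
  next
    fix f assume f: "f \<in> carrier R"
    then show "\<zero>\<^bsub>R\<^esub> \<oplus>\<^bsub>R\<^esub> f = f" by (simp add: ring_simps)
    from f have "(\<lambda>n. -1 * f n) \<in> A" unfolding ring_simps by (rule L1w_scale(1))
    then show "\<exists>g\<in>carrier R. g \<oplus>\<^bsub>R\<^esub> f = \<zero>\<^bsub>R\<^esub>"
      unfolding ring_simps by (rule bexI[rotated]) simp
  qed (simp add: ring_simps L1w_zero)
  show "comm_monoid R"
  proof (rule comm_monoidI)
    fix f g h assume "f \<in> carrier R" "g \<in> carrier R" "h \<in> carrier R"
    then show "f \<otimes>\<^bsub>R\<^esub> g \<otimes>\<^bsub>R\<^esub> h = f \<otimes>\<^bsub>R\<^esub> (g \<otimes>\<^bsub>R\<^esub> h)"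
      by (simp add: ring_simps convol_assoc)
  next
    fix f g assume fg: "f \<in> carrier R" "g \<in> carrier R"
    then show "f \<otimes>\<^bsub>R\<^esub> g \<in> carrier R" by (simp add: ring_simps L1w_convol)
    show "f \<otimes>\<^bsub>R\<^esub> g = g \<otimes>\<^bsub>R\<^esub> f" using fg convol_commute[of f g] by (simp add: ring_simps)
  qed (simp_all add: ring_simps L1w_delta convol_delta_0)
qed (simp add: ring_simps convol_add_left)

lemma ideal_subset: "ideal J R \<Longrightarrow> f \<in> J \<Longrightarrow> f \<in> A"
  using ideal.Icarr[of J R f] by (simp add: ring_simps)

lemma ideal_add: "ideal J R \<Longrightarrow> f \<in> J \<Longrightarrow> g \<in> J \<Longrightarrow> (\<lambda>n. f n + g n) \<in> J"
  using additive_subgroup.a_closed[OF ideal.axioms(1), of J R f g] by (simp add: ring_simps)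

lemma ideal_convol: "ideal J R \<Longrightarrow> f \<in> J \<Longrightarrow> h \<in> A \<Longrightarrow> convol h f \<in> J"
  using ideal.I_l_closed[of J R f h] by (simp add: ring_simps)

lemma ideal_scale: "ideal J R \<Longrightarrow> f \<in> J \<Longrightarrow> (\<lambda>n. c * f n) \<in> J"
  using ideal_convol[of J f "\<lambda>n. c * delta 0 n"] L1w_scale(1)[OF L1w_delta(1)] by (simp add: convol_delta)

lemma ideal_diff: "ideal J R \<Longrightarrow> f \<in> J \<Longrightarrow> g \<in> J \<Longrightarrow> (\<lambda>n. f n - g n) \<in> J"
  using ideal_add[of J f "\<lambda>n. -1 * g n"] ideal_scale[of J g "-1"] by simp

lemma L1w_idealI:
  assumes "J \<subseteq> A" "(\<lambda>_. 0) \<in> J"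
    and add: "\<And>f g. f \<in> J \<Longrightarrow> g \<in> J \<Longrightarrow> (\<lambda>n. f n + g n) \<in> J"
    and conv: "\<And>f h. f \<in> J \<Longrightarrow> h \<in> A \<Longrightarrow> convol h f \<in> J"
  shows "ideal J R"
proof (rule idealI)
  interpret cring R by (rule L1w_cring)
  show "ring R" by (rule ring_axioms)
  show "subgroup J (add_monoid R)"
  proof (rule subgroup.intro)
    fix f assume f: "f \<in> J"
    have "convol (\<lambda>n. -1 * delta 0 n) f \<in> J"
      by (rule conv[OF f L1w_scale(1)[OF L1w_delta(1)]])
    then have neg: "(\<lambda>n. - f n) \<in> J" by (simp only: convol_delta) simp
    have "\<ominus>\<^bsub>R\<^esub> f = (\<lambda>n. - f n)"
      by (rule minus_equality) (use f neg assms(1) in \<open>auto simp: ring_simps\<close>)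
    then show "inv\<^bsub>add_monoid R\<^esub> f \<in> J" using neg by (simp add: a_inv_def)
  qed (use assms in \<open>auto simp: ring_simps\<close>)
  show "h \<otimes>\<^bsub>R\<^esub> f \<in> J" "f \<otimes>\<^bsub>R\<^esub> h \<in> J" if "f \<in> J" "h \<in> carrier R" for f h
    using conv[of f h] convol_commute[of f h] that assms(1) by (auto simp: ring_simps)
qed

lemma closedin_L1w_iff:
  "closedin (L1w_topology w) J \<longleftrightarrow> J \<subseteq> A \<and> (\<forall>f\<in>A. (\<forall>e>0. \<exists>g\<in>J. nrm (\<lambda>n. f n - g n) < e) \<longrightarrow> f \<in> J)"
proof -
  have comm: "nrm (\<lambda>n. f n - g n) = nrm (\<lambda>n. g n - f n)" for f g
    by (simp add: L1w_norm_def norm_minus_commute)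
  interpret M: Metric_space A "\<lambda>f g. nrm (\<lambda>n. f n - g n)"
  proof
    show "(nrm (\<lambda>n. f n - g n) = 0) = (f = g)" if "f \<in> A" "g \<in> A" for f g
      using norm_le_nrm[OF L1w_diff(1)[OF that]] nrm_zero by auto
  qed (rule nrm_nonneg comm nrm_triangle; assumption?)+
  have "disjnt J (M.mball f r) \<longleftrightarrow> \<not> (\<exists>g\<in>J. nrm (\<lambda>n. f n - g n) < r)" if "J \<subseteq> A" "f \<in> A" for f r
    using that by (auto simp: disjnt_iff)
  then have "(\<exists>r>0. disjnt J (M.mball f r)) \<longleftrightarrow> \<not> (\<forall>e>0. \<exists>g\<in>J. nrm (\<lambda>n. f n - g n) < e)"
    if "J \<subseteq> A" "f \<in> A" for f
    using that by simp
  then show ?thesis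
    unfolding L1w_topology_def M.closedin_metric by blast
qed

text \<open>The ideal generated by \<open>J\<close> and \<open>h\<close> is the whole ring because
  otherwise Krull's theorem would give a maximal ideal above \<open>J\<close> containing
  \<open>h\<close>, which \<open>max\<close> excludes.\<close>

lemma in_ideal_of_convol_eq_0:
  assumes J: "ideal J R" and max: "\<And>M. maximalideal M R \<Longrightarrow> J \<subseteq> M \<Longrightarrow> h \<notin> M"
    and h: "h \<in> A" and f: "f \<in> A" and fh: "convol f h = (\<lambda>_. 0)"
  shows "f \<in> J"
proof -
  interpret cring R by (rule L1w_cring)
  have PI: "ideal (PIdl\<^bsub>R\<^esub> h) R" by (rule cgenideal_ideal) (simp add: h ring_simps)
  have JP: "ideal (J <+>\<^bsub>R\<^esub> PIdl\<^bsub>R\<^esub> h) R" by (rule add_ideals[OF J PI])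
  have sub: "J \<subseteq> J <+>\<^bsub>R\<^esub> PIdl\<^bsub>R\<^esub> h" "h \<in> J <+>\<^bsub>R\<^esub> PIdl\<^bsub>R\<^esub> h"
  proof -
    have z: "\<zero>\<^bsub>R\<^esub> \<in> J" "\<zero>\<^bsub>R\<^esub> \<in> PIdl\<^bsub>R\<^esub> h"
      using additive_subgroup.zero_closed ideal.axioms(1) J PI by blast+
    show "J \<subseteq> J <+>\<^bsub>R\<^esub> PIdl\<^bsub>R\<^esub> h"
      unfolding set_add_def' using z(2) by (force simp: ring_simps)
    have "h \<in> PIdl\<^bsub>R\<^esub> h" by (rule cgenideal_self) (simp add: h ring_simps)
    then show "h \<in> J <+>\<^bsub>R\<^esub> PIdl\<^bsub>R\<^esub> h"
      unfolding set_add_def' using z(1) by (force simp: ring_simps)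
  qed
  have "\<one>\<^bsub>R\<^esub> \<in> J <+>\<^bsub>R\<^esub> PIdl\<^bsub>R\<^esub> h"
    using exists_maximalideal[OF JP] max sub by blast
  then obtain j u where ju: "j \<in> J" "u \<in> A" "delta 0 = (\<lambda>n. j n + convol u h n)"
    unfolding set_add_def' cgenideal_def by (auto simp: ring_simps)
  have jA: "j \<in> A" using ju J ideal_subset by blast
  have "f = convol (delta 0) f" by (simp add: convol_delta_0)
  also have "\<dots> = (\<lambda>n. convol j f n + convol (convol u h) f n)"
    unfolding ju(3) by (rule convol_add_left[OF jA L1w_convol(1)[OF ju(2) h] f])
  also have "convol (convol u h) f = convol u (convol f h)"
    using convol_commute[OF h f] by (simp add: convol_assoc ju(2) h f)
  also have "convol u (convol f h) = (\<lambda>_. 0)" unfolding fh by (simp add: convol_def)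
  also have "convol j f = convol f j" by (rule convol_commute[OF jA f])
  finally have eq: "f = (\<lambda>n. convol f j n + 0)" .
  show ?thesis
    by (subst eq) (use ideal_convol[OF J ju(1) f] in simp)
qed

end

text \<open>The unweighted case. It serves the sequences \<open>n^j f(n)\<close> behind the moments,
  which are summable but need not lie in the weighted algebra.\<close>

interpretation l1: beurling "\<lambda>_. 1"
  by unfold_locales (simp add: weight_def)

lemma L1w_1_iff: "f \<in> L1w (\<lambda>_. 1) \<longleftrightarrow> l1 f"
  by (simp add: L1w_def)

lemma l1_convol: "l1 f \<Longrightarrow> l1 g \<Longrightarrow> l1 (convol f g)"
  using l1.L1w_convol(1) by (simp only: L1w_1_iff)

lemma l1_delta: "l1 (delta k)"
  using l1.L1w_delta(1) by (simp only: L1w_1_iff)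

section \<open>A smooth bump function\<close>

text \<open>\<open>ck K M f\<close>: \<open>f\<close> has \<open>K\<close> continuous derivatives, all of them (and \<open>f\<close>) bounded by
  \<open>M\<close> on \<open>[-3, 3]\<close>, the interval over which the kernel below is integrated.\<close>

primrec ck :: "nat \<Rightarrow> real \<Rightarrow> (real \<Rightarrow> 'a::real_normed_algebra_1) \<Rightarrow> bool" where
  "ck 0 M f \<longleftrightarrow> continuous_on UNIV f \<and> (\<forall>x\<in>{-3..3}. norm (f x) \<le> M)"
| "ck (Suc K) M f \<longleftrightarrow> (\<exists>f'. (\<forall>x. (f has_vector_derivative f' x) (at x)) \<and>
     (\<forall>x\<in>{-3..3}. norm (f x) \<le> M) \<and> ck K M f')"

lemma ck_bound: "ck K M f \<Longrightarrow> x \<in> {-3..3} \<Longrightarrow> norm (f x) \<le> M"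
  by (cases K) auto

lemma ck_nonneg: "ck K M f \<Longrightarrow> 0 \<le> M"
  using order.trans[OF norm_ge_zero ck_bound[of K M f 0]] by simp

lemma has_vector_derivative_continuous_on_UNIV:
  assumes "\<And>x. (f has_vector_derivative f' x) (at x)"
  shows "continuous_on S f"
  using assms by (intro continuous_at_imp_continuous_on ballI has_vector_derivative_continuous)

lemma ck_continuous_on: "ck K M f \<Longrightarrow> continuous_on S f"
  by (cases K) (auto intro: has_vector_derivative_continuous_on_UNIV continuous_on_subset)

lemma ck_mono: "ck K M f \<Longrightarrow> M \<le> M' \<Longrightarrow> ck K M' f"
proof (induction K arbitrary: f)
  case 0
  then show ?case by auto
next
  case (Suc K)
  then show ?case unfolding ck.simps(2) by (blast intro: order.trans)
qed

lemma ck_SucD: "ck (Suc K) M f \<Longrightarrow> ck K M f"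
proof (induction K arbitrary: f)
  case 0
  then show ?case by (auto intro: has_vector_derivative_continuous_on_UNIV)
next
  case (Suc K)
  then obtain f' where "\<And>x. (f has_vector_derivative f' x) (at x)" "ck (Suc K) M f'"
    unfolding ck.simps(2)[of "Suc K"] by blast
  then show ?case using Suc.IH ck_bound[OF Suc.prems] unfolding ck.simps(2)[of K M f] by blast
qed

lemma ck_add: "ck K M f \<Longrightarrow> ck K M' g \<Longrightarrow> ck K (M + M') (\<lambda>x. f x + g x)"
proof (induction K arbitrary: f g)
  case 0
  then show ?case by (auto intro!: continuous_intros intro: norm_triangle_mono)
next
  case (Suc K)
  then obtain f' g' where *: "\<And>x. (f has_vector_derivative f' x) (at x)" "ck K M f'"
    "\<And>x. (g has_vector_derivative g' x) (at x)" "ck K M' g'"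
    by auto
  show ?case
    unfolding ck.simps
    using Suc ck_bound[OF Suc.prems(1)] ck_bound[OF Suc.prems(2)] *
    by (intro exI[of _ "\<lambda>x. f' x + g' x"])
       (auto intro!: norm_triangle_mono has_vector_derivative_add)
qed

text \<open>Each use of the product rule doubles the number of terms, whence \<open>2 ^ K\<close>.
  The bound is kept bilinear in \<open>M\<close> and \<open>M'\<close> because later one factor is
  of size \<open>1 / L\<close> and this gain has to survive.\<close>

lemma ck_mult: "ck K M f \<Longrightarrow> ck K M' g \<Longrightarrow> ck K (2 ^ K * M * M') (\<lambda>x. f x * g x)"
proof (induction K arbitrary: f g)
  case 0
  have "norm (f x * g x) \<le> M * M'" if "x \<in> {-3..3}" for x
    using ck_bound[OF 0(1) that] ck_bound[OF 0(2) that] ck_nonneg[OF 0(1)]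
    by (intro order.trans[OF norm_mult_ineq] mult_mono) auto
  then show ?case using 0 by (auto intro!: continuous_intros)
next
  case (Suc K)
  then obtain f' g' where *: "\<And>x. (f has_vector_derivative f' x) (at x)" "ck K M f'"
    "\<And>x. (g has_vector_derivative g' x) (at x)" "ck K M' g'"
    by auto
  have nn: "0 \<le> M" "0 \<le> M'" using Suc.prems ck_nonneg by auto
  have "norm (f x * g x) \<le> 2 ^ Suc K * M * M'" if "x \<in> {-3..3}" for x
  proof -
    have "norm (f x * g x) \<le> M * M'"
      using ck_bound[OF Suc.prems(1) that] ck_bound[OF Suc.prems(2) that] nn
      by (intro order.trans[OF norm_mult_ineq] mult_mono) auto
    also have "\<dots> \<le> 2 ^ Suc K * (M * M')"
      using nn mult_right_mono[of 1 "2 ^ Suc K" "M * M'"] by (simp del: power_Suc)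
    finally show ?thesis by (simp add: mult_ac)
  qed
  moreover have "ck K (2 ^ K * M * M' + 2 ^ K * M * M') (\<lambda>x. f x * g' x + f' x * g x)"
    using Suc.prems * by (intro ck_add Suc.IH ck_SucD[of K M f] ck_SucD[of K M' g]) auto
  moreover have "((\<lambda>x. f x * g x) has_vector_derivative f x * g' x + f' x * g x) (at x)" for x
    using * by (intro has_vector_derivative_mult)
  moreover have "2 ^ K * M * M' + 2 ^ K * M * M' = 2 ^ Suc K * M * M'" by simp
  ultimately show ?case unfolding ck.simps(2) by (intro exI[of _ "\<lambda>x. f x * g' x + f' x * g x"]) simp
qed

lemma ck_SucI:
  assumes "\<And>x. (f has_vector_derivative f' x) (at x)" "ck K M f'"
  shows "\<exists>M. ck (Suc K) M f"
proof -
  have "bounded (f ` {-3..3})"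
    using assms by (intro compact_imp_bounded compact_continuous_image has_vector_derivative_continuous_on_UNIV) auto
  then obtain C where "\<And>x. x \<in> {-3..3} \<Longrightarrow> norm (f x) \<le> C"
    unfolding bounded_iff by blast
  then have "ck (Suc K) (max C M) f"
    unfolding ck.simps using assms ck_mono[OF assms(2), of "max C M"] by (auto simp: le_max_iff_disj)
  then show ?thesis ..
qed

lemma ck_0I: "continuous_on UNIV f \<Longrightarrow> \<exists>M. ck 0 M f"
  using compact_imp_bounded[OF compact_continuous_image[OF continuous_on_subset[of UNIV f "{-3..3}"] compact_Icc]]
  unfolding bounded_iff ck.simps by blast

lemma ck_of_real: "ck K M f \<Longrightarrow> ck K M (\<lambda>x. complex_of_real (f x))"
proof (induction K arbitrary: f)
  case 0
  then show ?case by (auto intro!: continuous_intros)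
next
  case (Suc K)
  then obtain f' where f': "\<And>x. (f has_vector_derivative f' x) (at x)" "ck K M f'" by auto
  have "((\<lambda>x. complex_of_real (f x)) has_vector_derivative complex_of_real (f' x)) (at x)" for x
    using f'(1)[of x] by (intro has_vector_derivative_of_real) (simp add: has_real_derivative_iff_has_vector_derivative)
  then show ?case
    using Suc.IH[OF f'(2)] ck_bound[OF Suc.prems] unfolding ck.simps by (intro exI[of _ "\<lambda>x. complex_of_real (f' x)"]) auto
qed

lemma ck_const: "\<exists>M. ck K M (\<lambda>_. c)"
proof (induction K arbitrary: c)
  case 0
  show ?case by (intro ck_0I continuous_intros)
next
  case (Suc K)
  then obtain M where "ck K M (\<lambda>_::real. 0::'a)" by blast
  then show ?case by (intro ck_SucI[where f' = "\<lambda>_. 0"] has_vector_derivative_const)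
qed

lemma ck_affine: "\<exists>M. ck K M (\<lambda>x::real. a * x + b)"
proof (cases K)
  case 0
  then show ?thesis by (auto intro!: ck_0I continuous_intros simp del: ck.simps)
next
  case (Suc K')
  obtain M where "ck K' M (\<lambda>_. a)" using ck_const by blast
  then show ?thesis unfolding Suc
    by (intro ck_SucI[where f' = "\<lambda>_. a"])
       (auto simp flip: has_real_derivative_iff_has_vector_derivative intro!: derivative_eq_intros)
qed

text \<open>The corner \<open>x = 0\<close> is the point of interest: there the difference quotient
  equals \<open>max 0 h ^ (m - 1)\<close> exactly, which tends to 0 because
  \<open>m \<ge> 2\<close>.\<close>

lemma DERIV_pos_part_power:
  assumes "2 \<le> m"
  shows "((\<lambda>x::real. max 0 x ^ m) has_real_derivative of_nat m * max 0 x ^ (m - 1)) (at x)"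
proof -
  consider "x < 0" | "x = 0" | "x > 0" by linarith
  then show ?thesis
  proof cases
    case 1
    have "((\<lambda>_. 0) has_real_derivative of_nat m * max 0 x ^ (m - 1)) (at x)"
      using 1 assms by (auto simp: max_def power_0_left)
    then show ?thesis
      by (rule has_field_derivative_transform_within_open[where S = "{..<0}"])
         (use 1 assms in \<open>auto simp: max_def power_0_left\<close>)
  next
    case 2
    have c: "isCont (\<lambda>h::real. max 0 h ^ (m - 1)) 0" by (intro continuous_intros)
    have "(\<lambda>h::real. max 0 h ^ (m - 1)) \<midarrow>0\<rightarrow> 0"
      using isContD[OF c] assms by (simp only: max.idem power_0_left) simp
    moreover have "eventually (\<lambda>h::real. max 0 h ^ (m - 1) = (max 0 (x + h) ^ m - max 0 x ^ m) / h) (at 0)"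
      using 2 assms by (auto simp: eventually_at_filter max_def power_0_left power_eq_if field_simps)
    ultimately have "(\<lambda>h. (max 0 (x + h) ^ m - max 0 x ^ m) / h) \<midarrow>0\<rightarrow> 0"
      by (rule Lim_transform_eventually)
    then show ?thesis
      unfolding DERIV_def using 2 assms by (simp add: power_0_left)
  next
    case 3
    have "((\<lambda>x. x ^ m) has_real_derivative of_nat m * max 0 x ^ (m - 1)) (at x)"
      using 3 by (auto intro!: derivative_eq_intros)
    then show ?thesis
      by (rule has_field_derivative_transform_within_open[where S = "{0<..}"]) (use 3 in auto)
  qed
qed

text \<open>A truncated power of exponent \<open>m\<close> is of class C^(m - 1). Its derivative has
  exponent \<open>m - 1\<close>, so order of smoothness and exponent decrease together in the
  induction.\<close>

lemma ck_pos_part_power: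
  fixes u :: "real \<Rightarrow> real"
  assumes "\<exists>M. ck K M u" "K < m"
  shows "\<exists>M. ck K M (\<lambda>x. max 0 (u x) ^ m)"
  using assms
proof (induction K arbitrary: m)
  case 0
  then show ?case by (auto intro!: ck_0I continuous_intros simp del: ck.simps dest: ck_continuous_on)
next
  case (Suc K)
  then obtain M u' where u: "ck (Suc K) M u" "\<And>x. (u has_vector_derivative u' x) (at x)" "ck K M u'"
    by auto
  obtain M1 where M1: "ck K M1 (\<lambda>x. max 0 (u x) ^ (m - 1))"
    using Suc.IH[of "m - 1"] Suc.prems(2) ck_SucD[OF u(1)] by force
  obtain M2 where M2: "ck K M2 (\<lambda>_. of_nat m :: real)" using ck_const by blast
  have "((\<lambda>x. max 0 (u x) ^ m) has_vector_derivative of_nat m * max 0 (u x) ^ (m - 1) * u' x) (at x)" for x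
    using Suc.prems(2) DERIV_chain2[OF DERIV_pos_part_power u(2)[folded has_real_derivative_iff_has_vector_derivative]]
    by (simp flip: has_real_derivative_iff_has_vector_derivative)
  then show ?case
    using ck_mult[OF ck_mult[OF M2 M1] u(3)] by (intro ck_SucI)
qed

text \<open>A plateau of height 1 on \<open>[-1, 1]\<close> with support in \<open>[-2, 2]\<close>:
  the inner truncated powers vanish on the plateau and add up to at least 1 outside
  \<open>(-2, 2)\<close>, where the outer positive part cuts to 0. The exponent \<open>Suc K\<close>
  makes both truncations of class C^K.\<close>

definition bump :: "nat \<Rightarrow> real \<Rightarrow> real" where
  "bump K x = max 0 (1 - (max 0 (x - 1) ^ Suc K + max 0 (- x - 1) ^ Suc K)) ^ Suc K"

lemma ck_bump: "\<exists>M. ck K M (bump K)"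
proof -
  obtain M1 where M1: "ck K M1 (\<lambda>x. max 0 (x - 1) ^ Suc K)"
    using ck_pos_part_power[of K "\<lambda>x. x - 1" "Suc K"] ck_affine[of K 1 "-1"] by auto
  obtain M2 where M2: "ck K M2 (\<lambda>x. max 0 (- x - 1) ^ Suc K)"
    using ck_pos_part_power[of K "\<lambda>x. - x - 1" "Suc K"] ck_affine[of K "-1" "-1"] by auto
  obtain M3 M4 where M3: "ck K M3 (\<lambda>_. 1 :: real)" and M4: "ck K M4 (\<lambda>_. -1 :: real)"
    using ck_const by blast
  have "ck K (M3 + 2 ^ K * M4 * (M1 + M2))
      (\<lambda>x. 1 + (-1) * (max 0 (x - 1) ^ Suc K + max 0 (- x - 1) ^ Suc K))"
    by (intro ck_add ck_mult M1 M2 M3 M4)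
  then have "\<exists>M. ck K M (\<lambda>x. max 0 (1 + (-1) * (max 0 (x - 1) ^ Suc K + max 0 (- x - 1) ^ Suc K)) ^ Suc K)"
    by (intro ck_pos_part_power) auto
  moreover have "bump K = (\<lambda>x. max 0 (1 + (-1) * (max 0 (x - 1) ^ Suc K + max 0 (- x - 1) ^ Suc K)) ^ Suc K)"
    by (rule ext) (simp add: bump_def algebra_simps del: power_Suc)
  ultimately show ?thesis by simp
qed

lemma bump_eq_1: "\<bar>x\<bar> \<le> 1 \<Longrightarrow> bump K x = 1"
  by (auto simp: bump_def max_def)

lemma bump_eq_0:
  assumes "2 \<le> \<bar>x\<bar>"
  shows "bump K x = 0"
proof -
  have "1 \<le> max 0 (x - 1) ^ Suc K + max 0 (- x - 1) ^ Suc K"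
  proof (cases "0 \<le> x")
    case True
    then have "1 \<le> max 0 (x - 1) ^ Suc K" using assms by (intro one_le_power) auto
    moreover have "0 \<le> max 0 (- x - 1) ^ Suc K" by (intro zero_le_power) auto
    ultimately show ?thesis by linarith
  next
    case False
    then have "1 \<le> max 0 (- x - 1) ^ Suc K" using assms by (intro one_le_power) auto
    moreover have "0 \<le> max 0 (x - 1) ^ Suc K" by (intro zero_le_power) auto
    ultimately show ?thesis by linarith
  qed
  then have "max 0 (1 - (max 0 (x - 1) ^ Suc K + max 0 (- x - 1) ^ Suc K)) = 0" by (simp only: max_absorb1 diff_le_0_iff_le)
  then show ?thesis by (simp only: bump_def) simp
qed

section \<open>Decay of Fourier integrals\<close>

text \<open>The factor \<open>\<i> * s\<close> stays on the left so that \<open>s = 0\<close> is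
  included. The boundary terms are kept: they vanish for functions supported in
  \<open>[-2, 2]\<close>, but in the inversion argument they are only bounded.\<close>

lemma integral_by_parts_exp:
  fixes f f' :: "real \<Rightarrow> complex"
  assumes ab: "a \<le> b" and f: "\<And>x. x \<in> {a..b} \<Longrightarrow> (f has_vector_derivative f' x) (at x)"
    and f': "continuous_on {a..b} f'"
  shows "\<i> * of_real s * integral {a..b} (\<lambda>x. f x * exp (\<i> * of_real (s * x))) =
    f b * exp (\<i> * of_real (s * b)) - f a * exp (\<i> * of_real (s * a)) -
      integral {a..b} (\<lambda>x. f' x * exp (\<i> * of_real (s * x)))"
proof -
  have fc: "continuous_on {a..b} f"
    using f by (intro continuous_at_imp_continuous_on ballI has_vector_derivative_continuous)
  let ?e = "\<lambda>x. exp (\<i> * of_real (s * x))"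
  have i1: "(\<lambda>x. f x * ?e x) integrable_on {a..b}" and i2: "(\<lambda>x. f' x * ?e x) integrable_on {a..b}"
    by (intro integrable_continuous_interval continuous_intros fc f')+
  have e: "(?e has_vector_derivative \<i> * of_real s * ?e x) (at x within S)" for x S
    by (auto intro!: derivative_eq_intros has_vector_derivative_real_field)
  have "((\<lambda>x. f x * (\<i> * of_real s * ?e x) + f' x * ?e x) has_integral f b * ?e b - f a * ?e a) {a..b}"
    by (intro fundamental_theorem_of_calculus ab has_vector_derivative_mult e)
       (use f in \<open>auto intro: has_vector_derivative_at_within\<close>)
  moreover have "((\<lambda>x. \<i> * of_real s * (f x * ?e x) + f' x * ?e x) has_integral
      \<i> * of_real s * integral {a..b} (\<lambda>x. f x * ?e x) + integral {a..b} (\<lambda>x. f' x * ?e x)) {a..b}"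
    by (intro has_integral_add has_integral_mult_right integrable_integral i1 i2)
  ultimately have "\<i> * of_real s * integral {a..b} (\<lambda>x. f x * ?e x) + integral {a..b} (\<lambda>x. f' x * ?e x) =
      f b * ?e b - f a * ?e a"
    by (intro has_integral_unique) (simp_all only: mult.left_commute)
  then show ?thesis by (simp add: eq_diff_eq)
qed

text \<open>This is \<open>K\<close> integrations by parts. The interval \<open>[-3, 3]\<close>, of
  length 6, is strictly larger than the support, so the boundary terms vanish.\<close>

lemma ck_decay:
  fixes f :: "real \<Rightarrow> complex"
  assumes "ck K M f" "\<And>x. 2 < \<bar>x\<bar> \<Longrightarrow> f x = 0"
  shows "\<bar>s\<bar> ^ K * norm (integral {-3..3} (\<lambda>x. f x * exp (\<i> * of_real (s * x)))) \<le> 6 * M"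
  using assms
proof (induction K arbitrary: f)
  case 0
  have "norm (integral {-3..3} (\<lambda>x. f x * exp (\<i> * of_real (s * x)))) \<le> M * (3 - (- 3))"
    using 0 by (intro integral_bound) (auto intro!: continuous_intros ck_continuous_on[OF 0(1)] simp: norm_mult norm_exp_eq_Re)
  then show ?case by simp
next
  case (Suc K)
  then obtain f' where f': "\<And>x. (f has_vector_derivative f' x) (at x)" "ck K M f'" by auto
  \<comment> \<open>Vanishing on an open set passes to the derivative, so the induction hypothesis
    applies to \<open>f'\<close>.\<close>
  have 0: "f' x = 0" if "2 < \<bar>x\<bar>" for x
  proof -
    have "open {x::real. 2 < \<bar>x\<bar>}" by (intro open_Collect_less continuous_intros)
    then have "((\<lambda>_. 0) has_vector_derivative f' x) (at x)"
      by (intro has_vector_derivative_transform_within_open[OF f'(1)[of x], of "{x. 2 < \<bar>x\<bar>}"])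
         (use that Suc.prems in auto)
    then show ?thesis using vector_derivative_unique_at has_vector_derivative_const by blast
  qed
  have "\<i> * of_real s * integral {-3..3} (\<lambda>x. f x * exp (\<i> * of_real (s * x))) =
      - integral {-3..3} (\<lambda>x. f' x * exp (\<i> * of_real (s * x)))"
    using integral_by_parts_exp[of "-3" 3 f f' s] f' ck_continuous_on[OF f'(2)] Suc.prems(2)[of 3] Suc.prems(2)[of "-3"]
    by simp
  from arg_cong[OF this, of norm] have "\<bar>s\<bar> * norm (integral {-3..3} (\<lambda>x. f x * exp (\<i> * of_real (s * x)))) =
      norm (integral {-3..3} (\<lambda>x. f' x * exp (\<i> * of_real (s * x))))"
    by (simp only: norm_mult norm_ii norm_minus_cancel norm_of_real mult_1)
  then show ?case
    using Suc.IH[OF f'(2) 0] by (simp only: power_Suc2 mult.assoc)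
qed

lemma ck_exp:
  assumes "\<bar>r\<bar> \<le> 1"
  shows "ck K (norm c) (\<lambda>x. c * exp (- \<i> * of_real (r * x)))"
proof (induction K arbitrary: c)
  case 0
  then show ?case by (auto intro!: continuous_intros simp: norm_mult norm_exp_eq_Re)
next
  case (Suc K)
  have "ck K (norm c) (\<lambda>x. (- \<i> * of_real r * c) * exp (- \<i> * of_real (r * x)))"
    by (rule ck_mono[OF Suc]) (use assms in \<open>simp add: norm_mult mult_left_le_one_le\<close>)
  moreover have "((\<lambda>x. c * exp (- \<i> * of_real (r * x))) has_vector_derivative
      (- \<i> * of_real r * c) * exp (- \<i> * of_real (r * x))) (at x)" for x
    by (auto intro!: derivative_eq_intros has_vector_derivative_real_field)
  ultimately show ?case unfolding ck.simps
    by (intro exI[of _ "\<lambda>x. (- \<i> * of_real r * c) * exp (- \<i> * of_real (r * x))"]) (simp add: norm_mult norm_exp_eq_Re)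
qed

lemma norm_exp_ii_minus_1_le: "norm (exp (- \<i> * of_real x) - 1) \<le> \<bar>x\<bar>"
proof -
  have "norm (exp (- \<i> * of_real x) - 1) = 2 * \<bar>sin (- x / 2)\<bar>"
    using dist_exp_i_1[of "- x"] by simp
  also have "\<dots> \<le> \<bar>x\<bar>"
    using abs_sin_x_le_abs_x[of "- x / 2"] by simp
  finally show ?thesis .
qed

text \<open>The source of the gain: with \<open>r = 1 / L\<close> the function and all its
  derivatives are of size \<open>1 / L\<close>. The value itself costs
  \<open>|r x| \<le> 3 |r|\<close> on \<open>[-3, 3]\<close>; every derivative carries a factor
  \<open>r\<close>.\<close>

lemma ck_exp_minus_1:
  assumes "\<bar>r\<bar> \<le> 1"
  shows "ck K (3 * \<bar>r\<bar>) (\<lambda>x. exp (- \<i> * of_real (r * x)) - 1)"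
proof -
  have b: "norm (exp (- \<i> * of_real (r * x)) - 1) \<le> 3 * \<bar>r\<bar>" if "x \<in> {-3..3}" for x
    using norm_exp_ii_minus_1_le[of "r * x"] that mult_right_mono[of "\<bar>x\<bar>" 3 "\<bar>r\<bar>"]
    by (auto simp: abs_mult mult.commute intro: order.trans)
  show ?thesis
  proof (cases K)
    case 0
    then show ?thesis using b by (auto intro!: continuous_intros)
  next
    case (Suc K')
    have "ck K' (3 * \<bar>r\<bar>) (\<lambda>x. (- \<i> * of_real r) * exp (- \<i> * of_real (r * x)))"
      by (rule ck_mono[OF ck_exp[OF assms]]) (simp add: norm_mult)
    moreover have "((\<lambda>x. exp (- \<i> * of_real (r * x)) - 1) has_vector_derivative
        (- \<i> * of_real r) * exp (- \<i> * of_real (r * x))) (at x)" for x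
      by (auto intro!: derivative_eq_intros has_vector_derivative_real_field)
    ultimately show ?thesis unfolding Suc ck.simps using b
      by (intro exI[of _ "\<lambda>x. (- \<i> * of_real r) * exp (- \<i> * of_real (r * x))"]) blast
  qed
qed

section \<open>Kernels with compactly supported Fourier transform\<close>

text \<open>The Fourier coefficients of \<open>bump K (L t)\<close>, after the substitution
  \<open>x = L t\<close>. In this form the bump and the interval stay fixed while \<open>L\<close>
  varies, so a single bound for the bump gives estimates uniform in \<open>L\<close>.\<close>

definition bump_kernel :: "nat \<Rightarrow> real \<Rightarrow> int \<Rightarrow> complex" where
  "bump_kernel K L n = of_real (1 / (2 * pi * L)) *
     integral {-3..3} (\<lambda>x. of_real (bump K x) * exp (\<i> * of_real (of_int n / L * x)))"

lemma continuous_on_bump: "continuous_on S (\<lambda>x. complex_of_real (bump K x))"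
  using ck_bump ck_of_real ck_continuous_on by blast

text \<open>Shifting \<open>n\<close> by one multiplies the integrand by
  \<open>exp (- \<i> x / L)\<close>, so each difference contributes one factor that is small for
  large \<open>L\<close>.\<close>

lemma delta_diff_power_kernel:
  "(convol delta_diff ^^ p) (bump_kernel K L) n = of_real (1 / (2 * pi * L)) *
     integral {-3..3} (\<lambda>x. (exp (- \<i> * of_real (1 / L * x)) - 1) ^ p * of_real (bump K x) *
       exp (\<i> * of_real (of_int n / L * x)))"
proof (induction p arbitrary: n)
  case 0
  then show ?case by (simp add: bump_kernel_def)
next
  case (Suc p)
  define g where "g = (\<lambda>x. (exp (- \<i> * of_real (1 / L * x)) - 1) ^ p * of_real (bump K x))"
  have g: "continuous_on {-3..3} g"
    unfolding g_def by (intro continuous_intros continuous_on_bump)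
  have i: "(\<lambda>x. g x * exp (\<i> * of_real (of_int n / L * x))) integrable_on {-3..3}" for n
    by (intro integrable_continuous_interval continuous_intros g)
  have e: "exp (\<i> * of_real (of_int (n - 1) / L * x)) =
      exp (- \<i> * of_real (1 / L * x)) * exp (\<i> * of_real (of_int n / L * x))" for x
    by (simp add: exp_add[symmetric] algebra_simps diff_divide_distrib)
  have "(convol delta_diff ^^ Suc p) (bump_kernel K L) n = of_real (1 / (2 * pi * L)) *
     (integral {-3..3} (\<lambda>x. g x * exp (\<i> * of_real (of_int (n - 1) / L * x))) -
      integral {-3..3} (\<lambda>x. g x * exp (\<i> * of_real (of_int n / L * x))))"
    by (simp only: funpow.simps o_apply convol_delta_diff Suc g_def right_diff_distrib)
  also have "integral {-3..3} (\<lambda>x. g x * exp (\<i> * of_real (of_int (n - 1) / L * x))) -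
      integral {-3..3} (\<lambda>x. g x * exp (\<i> * of_real (of_int n / L * x))) =
      integral {-3..3} (\<lambda>x. g x * exp (\<i> * of_real (of_int (n - 1) / L * x)) -
        g x * exp (\<i> * of_real (of_int n / L * x)))"
    by (rule integral_diff[symmetric]) (rule i)+
  also have "\<dots> = integral {-3..3} (\<lambda>x. (exp (- \<i> * of_real (1 / L * x)) - 1) ^ Suc p *
      of_real (bump K x) * exp (\<i> * of_real (of_int n / L * x)))"
    by (simp only: e g_def) (simp add: algebra_simps)
  finally show ?case .
qed

lemma ck_mult_exp_power:
  assumes "ck K M f" "1 \<le> L"
  shows "ck K ((2 ^ K * 3) ^ p * M / L ^ p) (\<lambda>x. (exp (- \<i> * of_real (1 / L * x)) - 1) ^ p * f x)"
proof (induction p)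
  case 0
  then show ?case using assms by simp
next
  case (Suc p)
  have "ck K (3 * \<bar>1 / L\<bar>) (\<lambda>x. exp (- \<i> * of_real (1 / L * x)) - 1)"
    using assms by (intro ck_exp_minus_1) auto
  from ck_mult[OF this Suc] show ?case
    using assms by (simp add: mult_ac)
qed

text \<open>Of the \<open>p + 1\<close> powers of \<open>1 / L\<close>, \<open>p\<close> come from
  the factors \<open>exp (- \<i> x / L) - 1\<close> and one from the prefactor
  \<open>1 / (2 pi L)\<close>. The decay is in the frequency \<open>s = n / L\<close>.\<close>

lemma delta_diff_power_kernel_bound:
  obtains C where "0 \<le> C"
    "\<And>L n. 1 \<le> L \<Longrightarrow>
       norm ((convol delta_diff ^^ p) (bump_kernel K L) n) \<le> C / L ^ Suc p / (1 + \<bar>of_int n / L\<bar>) ^ K"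
proof -
  obtain M where M: "ck K M (\<lambda>x. complex_of_real (bump K x))"
    using ck_bump ck_of_real by blast
  have M0: "0 \<le> M" using M by (rule ck_nonneg)
  define C where "C = 2 ^ K * 6 * ((2 ^ K * 3) ^ p * M)"
  have C0: "0 \<le> C" using M0 by (simp add: C_def)
  have "norm ((convol delta_diff ^^ p) (bump_kernel K L) n) \<le> C / L ^ Suc p / (1 + \<bar>of_int n / L\<bar>) ^ K"
    if L: "1 \<le> L" for L n
  proof -
    define g where "g = (\<lambda>x. (exp (- \<i> * of_real (1 / L * x)) - 1) ^ p * of_real (bump K x))"
    define s where "s = of_int n / L"
    define I where "I = norm (integral {-3..3} (\<lambda>x. g x * exp (\<i> * of_real (s * x))))"
    define D where "D = (2 ^ K * 3) ^ p * M / L ^ p"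
    have D0: "0 \<le> D" using M0 L by (simp add: D_def)
    have g: "ck K D g"
      unfolding g_def D_def by (rule ck_mult_exp_power[OF M L])
    have g0: "g x = 0" if "2 < \<bar>x\<bar>" for x
      using that bump_eq_0[of x K] by (simp add: g_def)
    have 1: "\<bar>s\<bar> ^ K * I \<le> 6 * D"
      using ck_decay[OF g g0] by (simp add: I_def)
    have "ck 0 D g" using ck_continuous_on[OF g] ck_bound[OF g] by simp
    then have 2: "I \<le> 6 * D"
      using ck_decay[of 0 D g s] g0 by (simp add: I_def)
    \<comment> \<open>For small \<open>s\<close> the bound without integration by parts is combined
      with \<open>1 + |s| \<le> 2\<close>, for large \<open>s\<close> the decay with
      \<open>1 + |s| \<le> 2 |s|\<close>; either way the loss is \<open>2 ^ K\<close>.\<close>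
    have "(1 + \<bar>s\<bar>) ^ K * I \<le> 2 ^ K * (6 * D)"
    proof (cases "\<bar>s\<bar> \<le> 1")
      case True
      then have "(1 + \<bar>s\<bar>) ^ K \<le> 2 ^ K" by (intro power_mono) auto
      then show ?thesis using 2 by (intro mult_mono) (auto simp: I_def)
    next
      case False
      then have "(1 + \<bar>s\<bar>) ^ K \<le> (2 * \<bar>s\<bar>) ^ K" by (intro power_mono) auto
      then have "(1 + \<bar>s\<bar>) ^ K * I \<le> (2 * \<bar>s\<bar>) ^ K * I" by (intro mult_right_mono) (auto simp: I_def)
      also have "\<dots> = 2 ^ K * (\<bar>s\<bar> ^ K * I)" by (simp add: power_mult_distrib)
      also have "\<dots> \<le> 2 ^ K * (6 * D)" using 1 by (intro mult_left_mono) auto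
      finally show ?thesis .
    qed
    then have 3: "I \<le> 2 ^ K * 6 * D / (1 + \<bar>s\<bar>) ^ K"
      by (simp add: field_simps)
    have "norm ((convol delta_diff ^^ p) (bump_kernel K L) n) = 1 / (2 * pi * L) * I"
      using L unfolding delta_diff_power_kernel norm_mult norm_of_real by (simp add: I_def g_def s_def)
    also have "\<dots> \<le> 1 / L * I"
      using L pi_ge_two by (intro mult_right_mono frac_le) (auto simp: I_def)
    also have "\<dots> \<le> 1 / L * (2 ^ K * 6 * D / (1 + \<bar>s\<bar>) ^ K)"
      using L 3 by (intro mult_left_mono) auto
    also have "\<dots> = C / L ^ Suc p / (1 + \<bar>s\<bar>) ^ K"
      by (simp add: C_def D_def mult_ac)
    finally show ?thesis unfolding s_def .
  qed
  with C0 that show ?thesis by blast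
qed

text \<open>Up to the factor \<open>L\<close> this is a Riemann sum of
  \<open>1 / (1 + |x|)^2\<close> with mesh \<open>1 / L\<close>, hence of size \<open>L\<close>.
  This \<open>L\<close> cancels the prefactor of the kernel.\<close>

lemma inverse_square_sum:
  fixes L :: real
  assumes L: "1 \<le> L"
  shows "(\<lambda>n::int. 1 / (1 + \<bar>of_int n / L\<bar>) ^ 2) summable_on UNIV"
    and "(\<Sum>\<^sub>\<infinity>n::int. 1 / (1 + \<bar>of_int n / L\<bar>) ^ 2) \<le> 4 * L"
proof -
  define b where "b = (\<lambda>n::int. 1 / (1 + \<bar>of_int n / L\<bar>) ^ 2)"
  have b: "b n = L ^ 2 / (L + \<bar>of_int n\<bar>) ^ 2" for n
    using L by (simp add: b_def field_simps)
  \<comment> \<open>The subtracted term makes the bound inductive. With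
    \<open>u = L + M + 1\<close>, it increases by \<open>4 L^2 / (u (u + 1))\<close>, which
    dominates the two new terms \<open>2 L^2 / u^2\<close> because
    \<open>u + 1 \<le> 2 u\<close>.\<close>
  have sym: "sum b {- int M..int M} \<le> 4 * L - 4 * L ^ 2 / (L + real M + 1)" for M
  proof (induction M)
    case 0
    have "1 \<le> 4 * L - 4 * L ^ 2 / (L + 1)"
      using L by (simp add: field_simps power2_eq_square)
    then show ?case using L by (simp add: b)
  next
    case (Suc M)
    have "{- int (Suc M)..int (Suc M)} = insert (int (Suc M)) (insert (- int (Suc M)) {- int M..int M})"
      by auto
    then have "sum b {- int (Suc M)..int (Suc M)} = 2 * (L ^ 2 / (L + real M + 1) ^ 2) + sum b {- int M..int M}"
      by (simp add: b add_ac del: atLeastAtMost_insertL)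
    also have "\<dots> \<le> 2 * (L ^ 2 / (L + real M + 1) ^ 2) + (4 * L - 4 * L ^ 2 / (L + real M + 1))"
      using Suc by simp
    also have "\<dots> \<le> 4 * L - 4 * L ^ 2 / (L + real (Suc M) + 1)"
    proof -
      define u where "u = L + real M + 1"
      have u: "2 \<le> u" using L by (simp add: u_def)
      have "2 * (L ^ 2 / u ^ 2) = L ^ 2 * (4 / (u * (2 * u)))"
        by (simp add: power2_eq_square)
      also have "\<dots> \<le> L ^ 2 * (4 / (u * (u + 1)))"
        using u by (intro mult_left_mono divide_left_mono) auto
      also have "4 / (u * (u + 1)) = 4 / u - 4 / (u + 1)"
        using u by (simp add: field_simps)
      finally show ?thesis by (simp add: u_def algebra_simps)
    qed
    finally show ?case .
  qed
  have fin: "sum b F \<le> 4 * L" if F: "finite F" for F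
  proof -
    obtain M where "F \<subseteq> {- int M..int M}"
    proof -
      have "bdd_above ((\<lambda>n. nat \<bar>n\<bar>) ` F)" using F by simp
      then obtain M where "\<forall>n\<in>F. nat \<bar>n\<bar> \<le> M" by (auto simp: bdd_above_def)
      then show ?thesis by (intro that[of M]) force
    qed
    then have "sum b F \<le> sum b {- int M..int M}"
      by (intro sum_mono2) (auto simp: b_def)
    also have "\<dots> \<le> 4 * L" using sym[of M] L by (smt (verit) divide_nonneg_nonneg of_nat_0_le_iff zero_le_power2)
    finally show ?thesis .
  qed
  have "b summable_on UNIV"
  proof (rule nonneg_bdd_above_summable_on)
    show "bdd_above (sum b ` {F. F \<subseteq> UNIV \<and> finite F})"
      using fin by (intro bdd_aboveI2[where M = "4 * L"]) auto
  qed (simp add: b_def)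
  then show "(\<lambda>n::int. 1 / (1 + \<bar>of_int n / L\<bar>) ^ 2) summable_on UNIV"
    and "(\<Sum>\<^sub>\<infinity>n::int. 1 / (1 + \<bar>of_int n / L\<bar>) ^ 2) \<le> 4 * L"
    using infsum_le_finite_sums[of b UNIV "4 * L"] fin by (simp_all add: b_def)
qed

text \<open>In terms of \<open>s = |n| / L\<close> the weight is at most a constant times
  \<open>L^\<beta> (1 + s)^(M + 1)\<close>. The choice \<open>K = M + 3\<close> leaves
  \<open>(1 + s)^(-2)\<close>, which sums to at most \<open>4 L\<close>. Two cases are used later:
  \<open>p = 0\<close> for membership and \<open>p = N + 1\<close> for smallness.\<close>

lemma delta_diff_power_kernel_norm:
  assumes w: "\<And>n. 0 \<le> w n" "\<And>n. w n \<le> c * (1 + of_int \<bar>n\<bar> powr \<beta>)"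
    and \<beta>: "0 \<le> \<beta>" "\<beta> \<le> real M + 1" and c: "0 \<le> c" and K: "K = M + 3"
  obtains C where
    "\<And>L. 1 \<le> L \<Longrightarrow> (convol delta_diff ^^ p) (bump_kernel K L) \<in> L1w w"
    "\<And>L. 1 \<le> L \<Longrightarrow> L1w_norm w ((convol delta_diff ^^ p) (bump_kernel K L)) \<le> C * L powr (\<beta> - real p)"
proof -
  obtain C where C0: "0 \<le> C" and C: "\<And>L n. 1 \<le> L \<Longrightarrow>
       norm ((convol delta_diff ^^ p) (bump_kernel K L) n) \<le> C / L ^ Suc p / (1 + \<bar>of_int n / L\<bar>) ^ K"
    using delta_diff_power_kernel_bound[of p K] by blast
  have bound: "norm ((convol delta_diff ^^ p) (bump_kernel K L) n) * w n \<le>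
      2 * c * C * L powr \<beta> / L ^ Suc p * (1 / (1 + \<bar>of_int n / L\<bar>) ^ 2)" if L: "1 \<le> L" for L n
  proof -
    define s where "s = \<bar>of_int n / L\<bar>"
    have s: "0 \<le> s" by (simp add: s_def)
    have n: "1 + of_int \<bar>n\<bar> \<le> L * (1 + s)" using L by (simp add: s_def field_simps)
    have "1 + of_int \<bar>n\<bar> powr \<beta> \<le> 2 * (1 + of_int \<bar>n\<bar>) powr \<beta>"
      using powr_mono2[of \<beta> "of_int \<bar>n\<bar>" "1 + of_int \<bar>n\<bar>"] ge_one_powr_ge_zero[of "1 + of_int \<bar>n\<bar>" \<beta>] \<beta>
      by simp
    also have "\<dots> \<le> 2 * (L * (1 + s)) powr \<beta>"
      using n \<beta> by (intro mult_left_mono powr_mono2) auto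
    also have "\<dots> = 2 * (L powr \<beta> * (1 + s) powr \<beta>)"
      using L s by (simp add: powr_mult)
    also have "(1 + s) powr \<beta> \<le> (1 + s) powr (real (M + 1))"
      using s \<beta> by (intro powr_mono) auto
    also have "\<dots> = (1 + s) ^ (M + 1)"
      using s by (intro powr_realpow) auto
    finally have "w n \<le> c * (2 * (L powr \<beta> * (1 + s) ^ (M + 1)))"
      using w(2)[of n] c by (meson mult_left_mono order.trans powr_ge_zero zero_le_numeral)
    moreover have "norm ((convol delta_diff ^^ p) (bump_kernel K L) n) \<le> C / L ^ Suc p / (1 + s) ^ K"
      using C[OF L] by (simp add: s_def)
    ultimately have "norm ((convol delta_diff ^^ p) (bump_kernel K L) n) * w n \<le>
        C / L ^ Suc p / (1 + s) ^ K * (c * (2 * (L powr \<beta> * (1 + s) ^ (M + 1))))"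
      using C0 L s w by (intro mult_mono) auto
    also have "(1 + s) ^ K = (1 + s) ^ (M + 1) * (1 + s) ^ 2"
      by (simp add: K power_add power3_eq_cube power2_eq_square)
    also have "C / L ^ Suc p / ((1 + s) ^ (M + 1) * (1 + s) ^ 2) * (c * (2 * (L powr \<beta> * (1 + s) ^ (M + 1)))) =
       2 * c * C * L powr \<beta> / L ^ Suc p * (1 / (1 + s) ^ 2)"
      using s by (simp add: field_simps del: power_Suc)
    finally show ?thesis unfolding s_def .
  qed
  have mem: "(convol delta_diff ^^ p) (bump_kernel K L) \<in> L1w w" if "1 \<le> L" for L
    unfolding L1w_def mem_Collect_eq
    by (rule summable_on_comparison_test[OF summable_on_cmult_right[OF inverse_square_sum(1)[OF that], of "2 * c * C * L powr \<beta> / L ^ Suc p"]])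
       (use bound[OF that] w in auto)
  have norm: "L1w_norm w ((convol delta_diff ^^ p) (bump_kernel K L)) \<le> 8 * c * C * L powr (\<beta> - real p)"
    if L: "1 \<le> L" for L
  proof -
    have "L1w_norm w ((convol delta_diff ^^ p) (bump_kernel K L)) \<le>
      (\<Sum>\<^sub>\<infinity>n. 2 * c * C * L powr \<beta> / L ^ Suc p * (1 / (1 + \<bar>of_int n / L\<bar>) ^ 2))"
      unfolding L1w_norm_def
      by (intro infsum_mono bound L summable_on_cmult_right inverse_square_sum)
         (use mem[OF L] in \<open>simp add: L1w_def\<close>)
    also have "\<dots> = 2 * c * C * L powr \<beta> / L ^ Suc p * (\<Sum>\<^sub>\<infinity>n. 1 / (1 + \<bar>of_int n / L\<bar>) ^ 2)"
      by (intro infsum_cmult_right inverse_square_sum L)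
    also have "\<dots> \<le> 2 * c * C * L powr \<beta> / L ^ Suc p * (4 * L)"
      using c C0 L by (intro mult_left_mono inverse_square_sum) auto
    also have "\<dots> = 8 * c * C * (L powr \<beta> / L ^ p)"
      using L by (simp add: field_simps)
    also have "L powr \<beta> / L ^ p = L powr (\<beta> - real p)"
      using L by (simp add: powr_diff powr_realpow)
    finally show ?thesis .
  qed
  from that mem norm show ?thesis by blast
qed

section \<open>Pointwise Fourier inversion for the kernel near 0\<close>

lemma tendsto_of_inverse_bound:
  fixes c :: "int \<Rightarrow> complex"
  assumes "\<And>n. \<bar>of_int n\<bar> * norm (c n) \<le> C" "0 \<le> C"
  shows "(\<lambda>M. c (int M)) \<longlonglongrightarrow> 0" "(\<lambda>M. c (- int M)) \<longlonglongrightarrow> 0"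
proof -
  have C: "(\<lambda>M. C / real M) \<longlonglongrightarrow> 0" by (rule lim_const_over_n)
  have "norm (c n) \<le> C / \<bar>of_int n\<bar>" if "n \<noteq> 0" for n
    using assms(1)[of n] that by (simp add: field_simps)
  then have *: "norm (c (int M)) \<le> C / real M" "norm (c (- int M)) \<le> C / real M" if "0 < M" for M
    using that by (metis abs_minus_cancel abs_of_nat of_int_minus of_int_of_nat_eq of_nat_eq_0_iff neg_equal_0_iff_equal less_irrefl)+
  show "(\<lambda>M. c (int M)) \<longlonglongrightarrow> 0" "(\<lambda>M. c (- int M)) \<longlonglongrightarrow> 0"
    by (rule Lim_null_comparison[OF _ C], use * in \<open>auto simp: eventually_at_top_dense intro!: exI[of _ 0]\<close>)+
qed

text \<open>The windows eventually contain every finite set. They are half-open so that a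
  telescoping sum over them ends exactly at \<open>- int M\<close> and \<open>int M\<close>.\<close>

lemma has_sum_imp_symmetric_limit:
  fixes f :: "int \<Rightarrow> complex"
  assumes "(f has_sum S) UNIV"
  shows "(\<lambda>M. sum f {- int M..<int M}) \<longlonglongrightarrow> S"
proof -
  have "filterlim (\<lambda>M. {- int M..<int M}) (finite_subsets_at_top UNIV) sequentially"
    unfolding filterlim_finite_subsets_at_top
  proof (intro allI impI)
    fix X :: "int set" assume X: "finite X \<and> X \<subseteq> UNIV"
    then have "bdd_above ((\<lambda>n. nat \<bar>n\<bar>) ` X)" by simp
    then obtain M where M: "\<forall>n\<in>X. nat \<bar>n\<bar> \<le> M" by (auto simp: bdd_above_def)
    have "X \<subseteq> {- int k..<int k}" if "M < k" for k
      using M that by force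
    then show "\<forall>\<^sub>F k in sequentially. finite {- int k..<int k} \<and> X \<subseteq> {- int k..<int k} \<and> {- int k..<int k} \<subseteq> UNIV"
      by (auto simp: eventually_at_top_dense)
  qed
  then show ?thesis
    using assms unfolding has_sum_def by (rule filterlim_compose[rotated])
qed

lemma sum_telescope_symmetric:
  fixes g :: "int \<Rightarrow> complex"
  shows "(\<Sum>n\<in>{- int M..<int M}. g n - g (n + 1)) = g (- int M) - g (int M)"
proof (induction M)
  case (Suc M)
  have eq: "{- int (Suc M)..<int (Suc M)} = insert (int M) (insert (- 1 - int M) {- int M..<int M})"
    by auto
  have "(\<Sum>n\<in>{- int (Suc M)..<int (Suc M)}. g n - g (n + 1)) =
      (g (int M) - g (int M + 1)) + ((g (- 1 - int M) - g (- 1 - int M + 1)) +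
        (\<Sum>n\<in>{- int M..<int M}. g n - g (n + 1)))"
    unfolding eq by simp
  then show ?case unfolding Suc by (simp add: algebra_simps)
qed simp

lemma integral_bump_extend:
  fixes h :: "real \<Rightarrow> complex"
  assumes "1 \<le> L"
  shows "integral {- (pi * L)..pi * L} (\<lambda>x. of_real (bump K x) * h x) =
         integral {-3..3} (\<lambda>x. of_real (bump K x) * h x)"
proof -
  have "3 \<le> pi * L" using mult_mono[of 3 pi 1 L] pi_gt3 assms by simp
  then have sub: "{-3..3} \<subseteq> {- (pi * L)..pi * L}" by auto
  have "integral {- (pi * L)..pi * L} (\<lambda>x. of_real (bump K x) * h x) =
      integral {- (pi * L)..pi * L} (\<lambda>x. if x \<in> {-3..3} then of_real (bump K x) * h x else 0)"
    by (rule integral_cong) (auto simp: bump_eq_0)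
  also have "\<dots> = integral {-3..3} (\<lambda>x. of_real (bump K x) * h x)"
    using sub by (simp only: integral_restrict_Int Int_absorb2)
  finally show ?thesis .
qed

lemma bump_deriv_eq_0:
  assumes "(bump K has_vector_derivative d) (at x)" "\<bar>x\<bar> < 1"
  shows "d = 0"
proof -
  have "((\<lambda>_. 1) has_vector_derivative d) (at x)"
    by (rule has_vector_derivative_transform_within_open[OF assms(1), of "{-1<..<1}"])
       (use assms(2) in \<open>auto simp: bump_eq_1\<close>)
  then show ?thesis using vector_derivative_unique_at has_vector_derivative_const by blast
qed

text \<open>
  The symmetric partial sums of the Fourier series of \<open>1 - bump (L t)\<close> telescope at a point \<open>t\<close> near
  which this function vanishes: dividing it by \<open>1 - exp (\<i> (x / L - t))\<close> gives a \<open>C\<^sup>1\<close> function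
  \<open>q\<close>, so that the terms are differences of consecutive Fourier coefficients of \<open>q\<close>.
\<close>

lemma fourier_bump_kernel_eq_1:
  assumes L: "1 \<le> L" and K: "1 \<le> K" and l1: "l1 (bump_kernel K L)" and t: "\<bar>t\<bar> < 1 / L"
  shows "fourier (bump_kernel K L) t = 1"
proof -
  define a where "a = pi * L"
  have a3: "3 \<le> a" using mult_mono[of 3 pi 1 L] pi_gt3 L by (simp add: a_def)
  obtain B where B: "\<And>x. (bump K has_vector_derivative B x) (at x)" and Bc: "continuous_on UNIV B"
  proof -
    obtain M where "ck K M (bump K)" using ck_bump by blast
    moreover obtain K' where "K = Suc K'" using K by (cases K) auto
    ultimately show ?thesis using that ck_continuous_on by (metis ck.simps(2))
  qed
  define d where "d = (\<lambda>x. 1 - exp (\<i> * of_real (x / L - t)))"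
  define d' where "d' = (\<lambda>x. - (\<i> / of_real L) * exp (\<i> * of_real (x / L - t)))"
  have d': "(d has_vector_derivative d' x) (at x)" for x
    unfolding d_def d'_def using L
    by (auto intro!: derivative_eq_intros has_vector_derivative_real_field simp: field_simps)
  define b where "b = (\<lambda>x. 1 - complex_of_real (bump K x))"
  define b' where "b' = (\<lambda>x. - complex_of_real (B x))"
  have b': "(b has_vector_derivative b' x) (at x)" for x
    unfolding b_def b'_def
    using has_vector_derivative_diff[OF has_vector_derivative_const
        has_vector_derivative_of_real[OF B[folded has_real_derivative_iff_has_vector_derivative]]]
    by simp
  define q where "q = (\<lambda>x. b x / d x)"
  define q' where "q' = (\<lambda>x. (b' x * d x - b x * d' x) / (d x * d x))"
  \<comment> \<open>Midpoint between \<open>|L t|\<close> and 1. The only zero of \<open>d\<close>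
    in the period is \<open>L t\<close>, so \<open>d\<close> is nonzero for
    \<open>|x| \<ge> r\<close>, while \<open>b\<close> vanishes for \<open>|x| \<le> 1\<close>; the
    two regions overlap, and \<open>q\<close> is smooth across them.\<close>
  define r where "r = (\<bar>L * t\<bar> + 1) / 2"
  have Lt: "\<bar>L * t\<bar> < 1" using t L by (simp add: abs_mult field_simps)
  then have r: "\<bar>L * t\<bar> < r" "r < 1" by (auto simp: r_def)
  have d_nz: "d x \<noteq> 0" if "x \<in> {- a..a}" "r \<le> \<bar>x\<bar>" for x
  proof
    assume "d x = 0"
    then have "cis (x / L - t) = 1" by (simp add: d_def cis_conv_exp)
    then obtain n where n: "x / L - t = of_int n * (2 * pi)" by (auto simp: cis_eq_1_iff)
    have "\<bar>x / L\<bar> \<le> pi" using that L by (auto simp: a_def abs_le_iff field_simps)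
    moreover have "\<bar>t\<bar> < pi" using t L pi_gt3 by (smt (verit) divide_le_eq_1)
    ultimately have "\<bar>of_int n * (2 * pi)\<bar> < 1 * (2 * pi)" using n by linarith
    then have "\<bar>real_of_int n\<bar> < 1" by (simp add: abs_mult)
    then have "n = 0" by linarith
    then have "x = L * t" using n L by (simp add: field_simps)
    then show False using that r by simp
  qed
  have b0: "b x = 0" if "\<bar>x\<bar> \<le> 1" for x using that by (simp add: b_def bump_eq_1)
  have b'0: "b' x = 0" if "\<bar>x\<bar> < 1" for x using bump_deriv_eq_0[OF B that] by (simp add: b'_def)
  \<comment> \<open>The numerators vanish on the plateau, so with division by zero giving 0 this
    includes the point \<open>x = L t\<close> where \<open>d\<close> is zero.\<close>
  have q0: "q x = 0" "q' x = 0" if "\<bar>x\<bar> < 1" for x using that b0 b'0 by (auto simp: q_def q'_def)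
  have qd: "q x * d x = b x" if "x \<in> {- a..a}" for x
    using d_nz[OF that] b0[of x] r by (cases "\<bar>x\<bar> < 1") (auto simp: q_def)
  have q': "(q has_vector_derivative q' x) (at x)" if x: "x \<in> {- a..a}" for x
  proof (cases "\<bar>x\<bar> < 1")
    case True
    have "((\<lambda>_. 0) has_vector_derivative q' x) (at x)" using q0[OF True] by simp
    then show ?thesis
      by (rule has_vector_derivative_transform_within_open[of _ _ _ "{-1<..<1}"]) (use q0 True in auto)
  next
    case False
    then have "d x \<noteq> 0" using d_nz x r by auto
    then show ?thesis
      using has_vector_derivative_mult[OF b' field_vector_diff_chain_at[OF d' DERIV_inverse]]
      by (simp add: q_def[abs_def] q'_def o_def field_simps power2_eq_square)
  qed
  have q'c: "continuous_on {- a..a} q'"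
  proof -
    have "continuous_on {- r..r} q'"
      using q0(2) r by (subst continuous_on_cong[OF refl, of _ _ "\<lambda>_. 0"]) auto
    moreover have "continuous_on ({- a..- r} \<union> {r..a}) q'"
    proof -
      have bd: "continuous_on S b" "continuous_on S d" for S
        using b' d' has_vector_derivative_continuous_on_UNIV by blast+
      have "continuous_on S b'" "continuous_on S d'" for S
        unfolding b'_def d'_def using L
        by (auto intro!: continuous_intros continuous_on_subset[OF Bc])
      then show ?thesis unfolding q'_def
        using r a3 by (intro continuous_intros bd) (use d_nz in force)+
    qed
    ultimately have "continuous_on ({- r..r} \<union> ({- a..- r} \<union> {r..a})) q'"
      by (rule continuous_on_closed_Un[rotated 2]) auto
    moreover have "{- a..a} \<subseteq> {- r..r} \<union> ({- a..- r} \<union> {r..a})" by auto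
    ultimately show ?thesis using continuous_on_subset by blast
  qed
  have qc: "continuous_on {- a..a} q"
    using q' by (intro continuous_at_imp_continuous_on ballI has_vector_derivative_continuous)
  define c where "c = (\<lambda>n. integral {- a..a} (\<lambda>x. q x * exp (\<i> * of_real (of_int n / L * x))))"
  \<comment> \<open>One integration by parts makes the coefficients of \<open>q\<close> of order
    \<open>1 / |n|\<close>, which sends both ends of the telescoping sum to 0.\<close>
  obtain C where C: "\<And>n. \<bar>of_int n\<bar> * norm (c n) \<le> C" "0 \<le> C"
  proof -
    obtain Q where Q: "\<And>x. x \<in> {- a..a} \<Longrightarrow> norm (q' x) \<le> Q"
      using compact_imp_bounded[OF compact_continuous_image[OF q'c compact_Icc]]
      unfolding bounded_iff by blast
    have Q0: "0 \<le> Q" using order.trans[OF norm_ge_zero Q[of 0]] a3 by simp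
    have "\<bar>of_int n\<bar> * norm (c n) \<le> L * (norm (q a) + norm (q (- a)) + Q * (a - (- a)))" for n
    proof -
      define e where "e = (\<lambda>x. exp (\<i> * complex_of_real (of_int n / L * x)))"
      have ne: "norm (e x) = 1" for x by (simp add: e_def norm_exp_eq_Re)
      have "\<i> * of_real (of_int n / L) * c n = q a * e a - q (- a) * e (- a) - integral {- a..a} (\<lambda>x. q' x * e x)"
        unfolding c_def e_def using a3 by (intro integral_by_parts_exp q' q'c) auto
      then have "norm (\<i> * of_real (of_int n / L) * c n) =
          norm (q a * e a - q (- a) * e (- a) - integral {- a..a} (\<lambda>x. q' x * e x))"
        by simp
      also have "\<dots> \<le> norm (q a * e a - q (- a) * e (- a)) + norm (integral {- a..a} (\<lambda>x. q' x * e x))"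
        by (rule norm_triangle_ineq4)
      also have "norm (q a * e a - q (- a) * e (- a)) \<le> norm (q a) + norm (q (- a))"
        by (rule order.trans[OF norm_triangle_ineq4]) (simp add: norm_mult ne)
      also have "norm (integral {- a..a} (\<lambda>x. q' x * e x)) \<le> Q * (a - (- a))"
        using a3 Q L by (intro integral_bound) (auto simp: norm_mult norm_exp_eq_Re e_def intro!: continuous_intros q'c)
      finally have "norm (\<i> * of_real (of_int n / L) * c n) \<le> norm (q a) + norm (q (- a)) + Q * (a - (- a))"
        by simp
      moreover have "norm (\<i> * of_real (of_int n / L) * c n) = \<bar>of_int n\<bar> * norm (c n) / L"
        using L by (simp only: norm_mult norm_of_real) simp
      ultimately have "\<bar>of_int n\<bar> * norm (c n) / L \<le> norm (q a) + norm (q (- a)) + Q * (a - (- a))"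
        by (simp only:)
      then show ?thesis using L by (simp only: pos_divide_le_eq mult.commute)
    qed
    moreover have "0 \<le> L * (norm (q a) + norm (q (- a)) + Q * (a - (- a)))"
      using L Q0 a3 by (intro mult_nonneg_nonneg add_nonneg_nonneg) auto
    ultimately show ?thesis using that by blast
  qed
  define g where "g = (\<lambda>n. exp (- \<i> * of_int n * of_real t) * c n)"
  define f where "f = (\<lambda>n. delta 0 n - bump_kernel K L n)"
  have term_eq: "f n * exp (- \<i> * of_int n * of_real t) = of_real (1 / (2 * pi * L)) * (g n - g (n + 1))" for n
  proof -
    define E where "E = (\<lambda>x. exp (\<i> * complex_of_real (of_int n / L * x)))"
    have E: "continuous_on S E" for S unfolding E_def by (intro continuous_intros)
    \<comment> \<open>\<open>delta 0\<close> is the coefficient sequence of the constant 1, so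
      \<open>f\<close> is that of \<open>1 - bump K (L t)\<close>, which is \<open>b\<close> in the
      variable \<open>x = L t\<close>.\<close>
    have "of_real (2 * pi * L) * delta 0 n = integral {- a..a} E"
      using integral_exp_of_int[of L n] L by (simp add: E_def a_def delta_def mult_ac)
    moreover have "of_real (2 * pi * L) * bump_kernel K L n = integral {- a..a} (\<lambda>x. of_real (bump K x) * E x)"
      using L by (simp add: bump_kernel_def a_def integral_bump_extend E_def)
    ultimately have "of_real (2 * pi * L) * f n =
        integral {- a..a} E - integral {- a..a} (\<lambda>x. of_real (bump K x) * E x)"
      by (simp add: f_def right_diff_distrib)
    also have "\<dots> = integral {- a..a} (\<lambda>x. E x - of_real (bump K x) * E x)"
      by (intro integral_diff[symmetric] integrable_continuous_interval continuous_intros continuous_on_bump E)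
    also have "\<dots> = integral {- a..a} (\<lambda>x. q x * E x - exp (- \<i> * of_real t) * (q x * exp (\<i> * of_real (of_int (n + 1) / L * x))))"
    proof (rule integral_cong)
      fix x assume "x \<in> {- a..a}"
      have "E x - of_real (bump K x) * E x = b x * E x" by (simp add: b_def algebra_simps)
      also have "b x = q x * d x" using qd[OF \<open>x \<in> {- a..a}\<close>] by simp
      also have "q x * d x * E x = q x * E x - q x * (exp (\<i> * of_real (x / L - t)) * E x)"
        by (simp add: d_def algebra_simps)
      \<comment> \<open>The factor \<open>exp (\<i> x / L)\<close> raises the frequency from
        \<open>n\<close> to \<open>n + 1\<close>, so the two terms are consecutive coefficients of
        \<open>q\<close>.\<close>
      also have "exp (\<i> * of_real (x / L - t)) * E x =
          exp (- \<i> * of_real t) * exp (\<i> * of_real (of_int (n + 1) / L * x))"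
        by (simp add: E_def exp_add[symmetric] algebra_simps add_divide_distrib)
      finally show "E x - of_real (bump K x) * E x =
        q x * E x - exp (- \<i> * of_real t) * (q x * exp (\<i> * of_real (of_int (n + 1) / L * x)))"
        by (simp add: mult_ac)
    qed
    also have "\<dots> = c n - exp (- \<i> * of_real t) * c (n + 1)"
      unfolding c_def E_def integral_mult_right[symmetric]
      by (intro integral_diff integrable_continuous_interval continuous_intros qc)
    finally have "of_real (2 * pi * L) * f n = c n - exp (- \<i> * of_real t) * c (n + 1)" .
    then have fn: "f n = of_real (1 / (2 * pi * L)) * (c n - exp (- \<i> * of_real t) * c (n + 1))"
      using L by (simp add: field_simps)
    have "exp (- \<i> * of_int (n + 1) * of_real t) =
        exp (- \<i> * of_int n * of_real t) * exp (- \<i> * of_real t)"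
      by (simp add: exp_add[symmetric] algebra_simps)
    then show ?thesis unfolding g_def fn by (simp only:) (simp only: algebra_simps)
  qed
  have g: "(\<lambda>M. g (int M)) \<longlonglongrightarrow> 0" "(\<lambda>M. g (- int M)) \<longlonglongrightarrow> 0"
    by (rule tendsto_of_inverse_bound[of g C]; use C in \<open>simp add: g_def norm_mult\<close>)+
  have "(\<lambda>M. of_real (1 / (2 * pi * L)) * (g (- int M) - g (int M))) \<longlonglongrightarrow> of_real (1 / (2 * pi * L)) * (0 - 0)"
    by (intro tendsto_intros g)
  then have lim0: "(\<lambda>M. \<Sum>n\<in>{- int M..<int M}. f n * exp (- \<i> * of_int n * of_real t)) \<longlonglongrightarrow> 0"
    by (simp only: term_eq sum_distrib_left[symmetric] sum_telescope_symmetric diff_self mult_zero_right)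
  from has_sum_add[OF fourier_has_sum[OF l1_delta[of 0], of t] has_sum_cmult_right[OF fourier_has_sum[OF l1, of t], of "-1"]]
  have "((\<lambda>n. f n * exp (- \<i> * of_int n * of_real t)) has_sum 1 - fourier (bump_kernel K L) t) UNIV"
    by (simp add: f_def fourier_delta left_diff_distrib)
  from LIMSEQ_unique[OF has_sum_imp_symmetric_limit[OF this] lim0] show ?thesis by simp
qed

text \<open>Up to a constant the convolution is the integral of the bump times a character times the
  dilated transform of \<open>f\<close>. The factor 3 confines the argument of that transform to
  \<open>|t| < 2 / (3 L) < 1 / L\<close>, where it is zero.\<close>

lemma convol_bump_kernel_eq_0:
  assumes f: "l1 f" and L: "1 \<le> L" and z: "\<And>t. \<bar>t\<bar> < 1 / L \<Longrightarrow> fourier f t = 0"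
  shows "convol f (bump_kernel K (3 * L)) = (\<lambda>_. 0)"
proof
  fix n
  let ?g = "\<lambda>x. of_real (bump K x) * exp (\<i> * of_real (of_int n / (3 * L) * x))"
  have "((\<lambda>m. f m * integral {-3..3} (\<lambda>x. ?g x * exp (- \<i> * of_int m * of_real (1 / (3 * L) * x))))
           has_sum integral {-3..3} (\<lambda>x. ?g x * fourier f (1 / (3 * L) * x))) UNIV"
    by (intro integral_mult_fourier f continuous_intros continuous_on_bump)
  moreover have "?g x * fourier f (1 / (3 * L) * x) = 0" for x
  proof (cases "\<bar>x\<bar> < 2")
    case True
    then have "\<bar>1 / (3 * L) * x\<bar> < 1 / L" using L by (simp add: abs_mult field_simps)
    then show ?thesis using z by simp
  qed (simp add: bump_eq_0)
  moreover have "?g x * exp (- \<i> * of_int m * of_real (1 / (3 * L) * x)) =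
      of_real (bump K x) * exp (\<i> * of_real (of_int (n - m) / (3 * L) * x))" for x m
    by (simp add: exp_add[symmetric] mult.assoc) (simp add: algebra_simps diff_divide_distrib)
  ultimately have "((\<lambda>m. f m * integral {-3..3} (\<lambda>x. of_real (bump K x) *
      exp (\<i> * of_real (of_int (n - m) / (3 * L) * x)))) has_sum 0) UNIV"
    by (simp only: integral_0)
  from has_sum_cmult_right[OF this, of "of_real (1 / (2 * pi * (3 * L)))"]
  have "((\<lambda>m. f m * bump_kernel K (3 * L) (n - m)) has_sum 0) UNIV"
    by (simp add: bump_kernel_def mult_ac)
  then show "convol f (bump_kernel K (3 * L)) n = 0"
    unfolding convol_def by (rule infsumI)
qed

section \<open>Moments and the ideals of vanishing order\<close>

text \<open>Up to the factor \<open>(- \<i>) ^ j\<close> this is the \<open>j\<close>-th derivative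
  of the transform at 0. Writing the sum as a value of \<open>fourier\<close> makes its linearity
  available.\<close>

definition moment :: "nat \<Rightarrow> (int \<Rightarrow> complex) \<Rightarrow> complex" where
  "moment j f = fourier (\<lambda>n. of_int n ^ j * f n) 0"

lemma fourier_0_has_sum: "l1 f \<Longrightarrow> (f has_sum fourier f 0) UNIV"
  using fourier_has_sum[of f 0] by simp

lemma has_sum_sum:
  fixes f :: "'i \<Rightarrow> 'a \<Rightarrow> 'b::topological_comm_monoid_add"
  assumes "finite I" "\<And>i. i \<in> I \<Longrightarrow> (f i has_sum s i) X"
  shows "((\<lambda>x. \<Sum>i\<in>I. f i x) has_sum (\<Sum>i\<in>I. s i)) X"
  using assms by (induction I rule: finite_induct) (auto intro!: has_sum_add)

text \<open>The Leibniz rule at 0, obtained by expanding \<open>n^j = (m + (n - m))^j\<close> under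
  the convolution sum.\<close>

lemma moment_convol:
  assumes f: "\<And>i. i \<le> j \<Longrightarrow> l1 (\<lambda>n. of_int n ^ i * f n)"
    and g: "\<And>i. i \<le> j \<Longrightarrow> l1 (\<lambda>n. of_int n ^ i * g n)"
  shows "moment j (convol f g) = (\<Sum>i\<le>j. of_nat (j choose i) * (moment i f * moment (j - i) g))"
proof -
  define P where "P = (\<lambda>i (f :: int \<Rightarrow> complex) n. of_int n ^ i * f n)"
  have f': "l1 (P i f)" and g': "l1 (P i g)" if "i \<le> j" for i using f[OF that] g[OF that] by (auto simp: P_def)
  have f0: "l1 f" and g0: "l1 g" using f'[of 0] g'[of 0] by (auto simp: P_def)
  have eq: "of_int n ^ j * convol f g n = (\<Sum>i\<le>j. of_nat (j choose i) * convol (P i f) (P (j - i) g) n)" for n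
  proof -
    have "((\<lambda>m. \<Sum>i\<le>j. of_nat (j choose i) * (P i f m * P (j - i) g (n - m))) has_sum
        (\<Sum>i\<le>j. of_nat (j choose i) * convol (P i f) (P (j - i) g) n)) UNIV"
      unfolding convol_def by (intro has_sum_sum has_sum_cmult_right has_sum_infsum convol_summable f' g') auto
    moreover have "(\<Sum>i\<le>j. of_nat (j choose i) * (P i f m * P (j - i) g (n - m))) = of_int n ^ j * (f m * g (n - m))" for m
    proof -
      have "(of_int n :: complex) ^ j = (of_int m + of_int (n - m)) ^ j" by simp
      also have "\<dots> = (\<Sum>i\<le>j. of_nat (j choose i) * of_int m ^ i * of_int (n - m) ^ (j - i))"
        by (rule binomial_ring)
      finally show ?thesis
        unfolding P_def by (simp only: sum_distrib_right) (simp add: mult_ac)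
    qed
    ultimately have "((\<lambda>m. of_int n ^ j * (f m * g (n - m))) has_sum
        (\<Sum>i\<le>j. of_nat (j choose i) * convol (P i f) (P (j - i) g) n)) UNIV"
      by simp
    moreover have "((\<lambda>m. of_int n ^ j * (f m * g (n - m))) has_sum of_int n ^ j * convol f g n) UNIV"
      unfolding convol_def by (intro has_sum_cmult_right has_sum_infsum convol_summable f0 g0)
    ultimately show ?thesis using has_sum_unique by blast
  qed
  have "((\<lambda>n. \<Sum>i\<le>j. of_nat (j choose i) * convol (P i f) (P (j - i) g) n) has_sum
      (\<Sum>i\<le>j. of_nat (j choose i) * fourier (convol (P i f) (P (j - i) g)) 0)) UNIV"
    by (intro has_sum_sum has_sum_cmult_right fourier_0_has_sum l1_convol f' g') auto
  then have "moment j (convol f g) = (\<Sum>i\<le>j. of_nat (j choose i) * fourier (convol (P i f) (P (j - i) g)) 0)"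
    unfolding moment_def fourier_def[of "\<lambda>n. of_int n ^ j * convol f g n"] by (simp add: eq infsumI)
  also have "\<dots> = (\<Sum>i\<le>j. of_nat (j choose i) * (moment i f * moment (j - i) g))"
    by (intro sum.cong refl) (simp add: fourier_convol f' g', simp add: moment_def P_def)
  finally show ?thesis .
qed

lemma moment_delta: "moment j (delta k) = of_int k ^ j"
proof -
  have "(\<lambda>n. of_int n ^ j * delta k n) = (\<lambda>n. of_int k ^ j * delta k n)"
    by (auto simp: delta_def)
  then show ?thesis by (simp add: moment_def fourier_scale l1_delta fourier_delta)
qed

locale poly_beurling = beurling w for w +
  fixes N :: nat and c1 c2 \<alpha> :: real
  assumes c1: "0 < c1" and c2: "0 < c2" and \<alpha>: "0 < \<alpha>" "\<alpha> < 1"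
    and w_lower: "c1 * (1 + of_int \<bar>m\<bar> ^ N) \<le> w m"
    and w_upper: "w m \<le> c2 * (1 + of_int \<bar>m\<bar> powr (of_nat N + \<alpha>))"
begin

lemma norm_power_le:
  fixes f :: "int \<Rightarrow> complex"
  assumes "j \<le> N"
  shows "norm (of_int n ^ j * f n) \<le> norm (f n) * w n / c1"
proof -
  have "\<bar>of_int n\<bar> ^ j \<le> 1 + real_of_int \<bar>n\<bar> ^ N"
  proof (cases "n = 0")
    case False
    then have "\<bar>of_int n\<bar> ^ j \<le> real_of_int \<bar>n\<bar> ^ N"
      using assms by (simp only: of_int_abs) (intro power_increasing; linarith)
    then show ?thesis by linarith
  qed (simp add: power_0_left)
  also have "\<dots> \<le> w n / c1"
    using w_lower[of n] c1 by (simp add: field_simps)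
  finally have "\<bar>of_int n\<bar> ^ j * norm (f n) \<le> w n / c1 * norm (f n)"
    by (rule mult_right_mono) simp
  then show ?thesis by (simp add: norm_mult norm_power mult.commute)
qed

lemma power_l1:
  assumes "f \<in> A" "j \<le> N"
  shows "l1 (\<lambda>n. of_int n ^ j * f n)"
proof -
  have "(\<lambda>n. norm (f n) * w n * (1 / c1)) summable_on UNIV"
    by (intro summable_on_cmult_left L1w_summable assms)
  then show ?thesis
    by (rule summable_on_comparison_test) (use norm_power_le[OF assms(2)] in auto)
qed

lemma norm_moment_le:
  assumes "f \<in> A" "j \<le> N"
  shows "norm (moment j f) \<le> nrm f / c1"
proof -
  have "((\<lambda>n. norm (f n) * w n * (1 / c1)) has_sum nrm f * (1 / c1)) UNIV"
    unfolding L1w_norm_def by (intro has_sum_cmult_left has_sum_infsum L1w_summable assms)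
  then show ?thesis
    using norm_infsum_le[OF fourier_0_has_sum[OF power_l1[OF assms]]] norm_power_le[OF assms(2)]
    by (simp add: moment_def)
qed

lemma moment_add: "f \<in> A \<Longrightarrow> g \<in> A \<Longrightarrow> j \<le> N \<Longrightarrow> moment j (\<lambda>n. f n + g n) = moment j f + moment j g"
  unfolding moment_def using fourier_add[OF power_l1 power_l1] by (simp add: distrib_left)

lemma moment_scale: "f \<in> A \<Longrightarrow> j \<le> N \<Longrightarrow> moment j (\<lambda>n. c * f n) = c * moment j f"
  unfolding moment_def using fourier_scale[OF power_l1, of f j c] by (simp add: mult.left_commute)

lemma moment_diff: "f \<in> A \<Longrightarrow> g \<in> A \<Longrightarrow> j \<le> N \<Longrightarrow> moment j (\<lambda>n. f n - g n) = moment j f - moment j g"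
  using moment_add[of f "\<lambda>n. -1 * g n" j] L1w_scale(1)[of g "-1"] moment_scale[of g j "-1"] by simp

lemma moment_convol_L1w:
  "f \<in> A \<Longrightarrow> g \<in> A \<Longrightarrow> j \<le> N \<Longrightarrow>
    moment j (convol f g) = (\<Sum>i\<le>j. of_nat (j choose i) * (moment i f * moment (j - i) g))"
  by (rule moment_convol) (auto intro: power_l1)

lemma nth_derivative_fourier:
  assumes f: "f \<in> A"
  shows "j \<le> N \<Longrightarrow> nth_derivative j (fourier f) = fourier (\<lambda>n. (- \<i>) ^ j * (of_int n ^ j * f n))"
proof (induction j)
  case 0
  then show ?case by (simp add: nth_derivative_def)
next
  case (Suc j)
  let ?g = "\<lambda>n. (- \<i>) ^ j * (of_int n ^ j * f n)"
  have eq: "- \<i> * of_int n * ?g n = (- \<i>) ^ Suc j * (of_int n ^ Suc j * f n)" for n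
    by (simp add: mult_ac)
  have l: "l1 (\<lambda>n. (- \<i>) ^ i * (of_int n ^ i * f n))" if "i \<le> N" for i
    using power_l1[OF f that] by (simp add: norm_mult norm_power)
  have "(fourier ?g has_vector_derivative fourier (\<lambda>n. - \<i> * of_int n * ?g n) t) (at t)" for t
  proof (rule fourier_has_vector_derivative)
    show "l1 ?g" by (rule l) (use Suc.prems in simp)
    show "l1 (\<lambda>n. - \<i> * of_int n * ?g n)" unfolding eq by (rule l[OF Suc.prems])
  qed
  then have "vector_derivative (fourier ?g) (at t) = fourier (\<lambda>n. (- \<i>) ^ Suc j * (of_int n ^ Suc j * f n)) t" for t
    unfolding eq by (rule vector_derivative_at)
  then show ?case
    using Suc by (simp add: nth_derivative_def)
qed

text \<open>Counting the vanishing moments, instead of naming the last one, gives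
  \<open>E 0 = A\<close> as the start of the inductions.\<close>

definition E :: "nat \<Rightarrow> (int \<Rightarrow> complex) set" where
  "E m = {f \<in> A. \<forall>j<m. moment j f = 0}"

lemma E_subset: "f \<in> E m \<Longrightarrow> f \<in> A"
  by (simp add: E_def)

lemma E_moment: "f \<in> E m \<Longrightarrow> j < m \<Longrightarrow> moment j f = 0"
  by (simp add: E_def)

lemma E_antimono: "m \<le> m' \<Longrightarrow> E m' \<subseteq> E m"
  by (auto simp: E_def)

lemma E_0: "E 0 = A"
  by (simp add: E_def)

lemma I_ideal_eq: 
  assumes "k \<le> N"
  shows "I_ideal w k = E (Suc k)"
proof -
  have "nth_derivative j (fourier f) 0 = (- \<i>) ^ j * moment j f" if "f \<in> A" "j \<le> k" for f j
    using nth_derivative_fourier[OF that(1), of j] fourier_scale[OF power_l1[OF that(1)], of j "(- \<i>) ^ j" 0] that assms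
    by (simp add: moment_def)
  then show ?thesis
    unfolding I_ideal_def E_def by (auto simp: less_Suc_eq_le)
qed

lemma E_ideal:
  assumes m: "m \<le> Suc N"
  shows "ideal (E m) R"
proof (rule L1w_idealI)
  show "(\<lambda>_. 0) \<in> E m"
    by (simp add: E_def L1w_zero moment_def fourier_def)
  show "(\<lambda>n. f n + g n) \<in> E m" if "f \<in> E m" "g \<in> E m" for f g
    using that m by (auto simp: E_def L1w_add moment_add)
  show "convol h f \<in> E m" if f: "f \<in> E m" and h: "h \<in> A" for f h
  proof -
    have "moment j (convol h f) = 0" if j: "j < m" for j
    proof -
      have "moment j (convol h f) = (\<Sum>i\<le>j. of_nat (j choose i) * (moment i h * moment (j - i) f))"
        by (rule moment_convol_L1w[OF h E_subset[OF f]]) (use j m in auto)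
      also have "\<dots> = 0"
        by (rule sum.neutral) (use E_moment[OF f] j in auto)
      finally show ?thesis .
    qed
    then show ?thesis using L1w_convol(1)[OF h E_subset[OF f]] by (simp add: E_def)
  qed
qed (auto simp: E_def)

text \<open>For \<open>j \<le> N\<close> the \<open>j\<close>-th moment is bounded by
  \<open>nrm f / c1\<close>, so a nonzero moment of \<open>f\<close> keeps \<open>f\<close> at a
  positive distance from \<open>E m\<close>.\<close>

lemma E_closedin:
  assumes m: "m \<le> Suc N"
  shows "closedin (L1w_topology w) (E m)"
  unfolding closedin_L1w_iff
proof (intro conjI ballI impI)
  show "E m \<subseteq> A" by (auto simp: E_def)
  fix f assume f: "f \<in> A" and approx: "\<forall>e>0. \<exists>g\<in>E m. nrm (\<lambda>n. f n - g n) < e"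
  have "moment j f = 0" if j: "j < m" for j
  proof (rule ccontr)
    assume nz: "moment j f \<noteq> 0"
    then have "0 < c1 * norm (moment j f)" using c1 by simp
    then obtain g where g: "g \<in> E m" "nrm (\<lambda>n. f n - g n) < c1 * norm (moment j f)"
      using approx by blast
    have "norm (moment j (\<lambda>n. f n - g n)) \<le> nrm (\<lambda>n. f n - g n) / c1"
      by (intro norm_moment_le L1w_diff f E_subset[OF g(1)]) (use j m in auto)
    moreover have "moment j (\<lambda>n. f n - g n) = moment j f"
      using moment_diff[OF f E_subset[OF g(1)], of j] E_moment[OF g(1) j] j m by simp
    ultimately show False using g(2) c1 by (simp add: field_simps)
  qed
  then show "f \<in> E m" using f by (simp add: E_def)
qed

section \<open>Multiplication by powers of \<open>x\<close> and the order of vanishing\<close>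

abbreviation X :: "(int \<Rightarrow> complex) \<Rightarrow> int \<Rightarrow> complex" where "X \<equiv> convol delta_diff"

lemma delta_diff_A: "delta_diff \<in> A"
  unfolding delta_diff_def by (intro L1w_diff L1w_delta)

lemma X_power_A: "f \<in> A \<Longrightarrow> (X ^^ p) f \<in> A"
  by (induction p) (auto intro: L1w_convol delta_diff_A)

lemma X_power_diff: "(X ^^ p) (\<lambda>n. f n - g n) = (\<lambda>n. (X ^^ p) f n - (X ^^ p) g n)"
  by (induction p) (auto simp: convol_delta_diff fun_eq_iff)

lemma X_power_scale: "(X ^^ p) (\<lambda>n. c * f n) = (\<lambda>n. c * (X ^^ p) f n)"
  by (induction p) (auto simp: convol_delta_diff fun_eq_iff algebra_simps)

lemma X_power_convol: "f \<in> A \<Longrightarrow> g \<in> A \<Longrightarrow> convol ((X ^^ p) f) g = (X ^^ p) (convol f g)"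
  by (induction p) (auto simp: convol_assoc delta_diff_A X_power_A L1w_convol)

text \<open>Iterates of the operator \<open>X\<close> stand for the powers of \<open>x\<close>, so
  that the pointwise difference formula applies; this is the link back to multiplication by the ring
  element \<open>x^p\<close>.\<close>

lemma X_power_delta_convol: "f \<in> A \<Longrightarrow> convol ((X ^^ p) (delta 0)) f = (X ^^ p) f"
  using X_power_convol[OF L1w_delta(1)] by (simp add: convol_delta_0)

lemma fourier_X_power: "f \<in> A \<Longrightarrow> fourier ((X ^^ p) f) t = (exp (- \<i> * of_real t) - 1) ^ p * fourier f t"
proof (induction p)
  case (Suc p)
  have "fourier delta_diff t = exp (- \<i> * of_real t) - 1"
    unfolding delta_diff_def by (simp add: fourier_diff_L1w L1w_delta fourier_delta)
  then show ?case
    using Suc by (simp add: fourier_convol_L1w delta_diff_A X_power_A mult.assoc)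
qed simp

lemma moment_delta_diff: "j \<le> N \<Longrightarrow> moment j delta_diff = (if j = 0 then 0 else 1)"
  unfolding delta_diff_def by (simp add: moment_diff L1w_delta moment_delta power_0_left)

text \<open>In the Leibniz sum the term \<open>i = 0\<close> dies because \<open>x\<close> has sum
  0, and those with \<open>i \<ge> 2\<close> die because \<open>j - i < m\<close>; only
  \<open>i = 1\<close> survives.\<close>

lemma moment_X:
  assumes f: "f \<in> E m" and j: "j \<le> Suc m" "j \<le> N"
  shows "moment j (X f) = of_nat j * moment (j - 1) f"
proof -
  have "moment j (X f) = (\<Sum>i\<le>j. of_nat (j choose i) * (moment i delta_diff * moment (j - i) f))"
    by (rule moment_convol_L1w[OF delta_diff_A E_subset[OF f] j(2)])
  also have "\<dots> = (\<Sum>i\<in>{1} \<inter> {..j}. of_nat (j choose i) * (moment i delta_diff * moment (j - i) f))"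
  proof (rule sum.mono_neutral_right)
    show "\<forall>i\<in>{..j} - {1} \<inter> {..j}. of_nat (j choose i) * (moment i delta_diff * moment (j - i) f) = 0"
    proof
      fix i assume "i \<in> {..j} - {1} \<inter> {..j}"
      then consider "i = 0" | "2 \<le> i" "i \<le> j" by force
      then show "of_nat (j choose i) * (moment i delta_diff * moment (j - i) f) = 0"
      proof cases
        case 1
        then show ?thesis by (simp add: moment_delta_diff)
      next
        case 2
        then show ?thesis using E_moment[OF f, of "j - i"] j by simp
      qed
    qed
  qed auto
  also have "\<dots> = of_nat j * moment (j - 1) f"
    using j by (cases j) (auto simp: moment_delta_diff)
  finally show ?thesis .
qed

lemma X_E:
  assumes f: "f \<in> E m" and m: "m \<le> N"
  shows "X f \<in> E (Suc m)"
proof -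
  have "moment j (X f) = 0" if "j < Suc m" for j
    using moment_X[OF f, of j] E_moment[OF f, of "j - 1"] that m by (cases j) auto
  then show ?thesis
    using L1w_convol(1)[OF delta_diff_A E_subset[OF f]] by (simp add: E_def)
qed

lemma X_power_E: "f \<in> E m \<Longrightarrow> m + p \<le> Suc N \<Longrightarrow> (X ^^ p) f \<in> E (m + p)"
  by (induction p) (auto intro: X_E)

lemma X_power_delta_E: "p \<le> Suc N \<Longrightarrow> (X ^^ p) (delta 0) \<in> E p"
  using X_power_E[of "delta 0" 0 p] by (simp add: E_0 L1w_delta)

lemma moment_X_power_delta: "p \<le> N \<Longrightarrow> moment p ((X ^^ p) (delta 0)) = fact p"
proof (induction p)
  case 0
  then show ?case by (simp add: moment_delta)
next
  case (Suc p)
  then show ?case using moment_X[OF X_power_delta_E, of p "Suc p"] by simp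
qed

text \<open>The \<open>m\<close>-th moment of \<open>x^m\<close> is \<open>m!\<close>, which fixes
  the coefficient. Thus \<open>E m\<close> modulo \<open>E (Suc m)\<close> is spanned by
  \<open>x^m\<close>.\<close>

lemma E_reduce:
  assumes f: "f \<in> E m" and m: "m \<le> N"
  shows "(\<lambda>n. f n - moment m f / fact m * (X ^^ m) (delta 0) n) \<in> E (Suc m)"
proof -
  let ?x = "(X ^^ m) (delta 0)"
  let ?c = "moment m f / fact m"
  have x: "?x \<in> E m" using X_power_delta_E m by simp
  have "(\<lambda>n. f n - ?c * ?x n) \<in> E m"
    by (intro ideal_diff[OF E_ideal] ideal_scale[OF E_ideal] f x) (use m in auto)
  moreover have "moment m (\<lambda>n. f n - ?c * ?x n) = moment m f - ?c * moment m ?x"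
    using moment_diff[OF E_subset[OF f] L1w_scale(1)[OF E_subset[OF x], of ?c] m]
      moment_scale[OF E_subset[OF x] m, of ?c]
    by (simp only:)
  ultimately show ?thesis
    using m by (auto simp: E_def less_Suc_eq moment_X_power_delta)
qed

lemma E_subset_ideal_step:
  assumes J: "ideal J R" and m: "m \<le> N" and E: "E (Suc m) \<subseteq> J" and x: "(X ^^ m) (delta 0) \<in> J"
  shows "E m \<subseteq> J"
proof
  fix f assume f: "f \<in> E m"
  have "(\<lambda>n. f n - moment m f / fact m * (X ^^ m) (delta 0) n) \<in> J"
    using E_reduce[OF f m] E by blast
  from ideal_add[OF J this ideal_scale[OF J x, of "moment m f / fact m"]]
  show "f \<in> J" by simp
qed

text \<open>Truncate \<open>f\<close> to a finite set and write the truncation as a combination of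
  \<open>\<delta>_n - \<delta>_0\<close>, each a multiple of \<open>x\<close>, plus a multiple
  \<open>s \<delta>_0\<close>, which is small because \<open>f\<close> has sum 0.\<close>

lemma delta_diff_approx:
  assumes f: "f \<in> E 1" and e: "0 < e"
  shows "\<exists>g\<in>A. nrm (\<lambda>n. f n - X g n) < e"
proof -
  have fA: "f \<in> A" by (rule E_subset[OF f])
  have d: "\<exists>g\<in>A. (\<lambda>m. delta n m - delta 0 m) = X g" for n
  proof (induction n rule: int_induct[where k = 0])
    case base
    show ?case by (rule bexI[OF _ L1w_zero]) (simp add: convol_delta_diff fun_eq_iff)
  next
    case (step1 n)
    then obtain g where g: "g \<in> A" "(\<lambda>m. delta n m - delta 0 m) = X g" by blast
    have "delta n (m - 1) = delta (n + 1) m" for m by (auto simp: delta_def)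
    then have "delta (n + 1) m - delta 0 m = X (\<lambda>m. g m + delta n m) m" for m
      using fun_cong[OF g(2), of m] by (simp add: convol_delta_diff algebra_simps)
    then show ?case using L1w_add(1)[OF g(1) L1w_delta(1)[of n]] by blast
  next
    case (step2 n)
    then obtain g where g: "g \<in> A" "(\<lambda>m. delta n m - delta 0 m) = X g" by blast
    have "delta (n - 1) (m - 1) = delta n m" for m by (auto simp: delta_def)
    then have "delta (n - 1) m - delta 0 m = X (\<lambda>m. g m - delta (n - 1) m) m" for m
      using fun_cong[OF g(2), of m] by (simp add: convol_delta_diff algebra_simps)
    then show ?case using L1w_diff(1)[OF g(1) L1w_delta(1)[of "n - 1"]] by blast
  qed
  have fin: "\<exists>g\<in>A. (\<lambda>m. \<Sum>n\<in>F. f n * (delta n m - delta 0 m)) = X g" if "finite F" for F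
    using that
  proof (induction F rule: finite_induct)
    case empty
    show ?case by (rule bexI[OF _ L1w_zero]) (simp add: convol_delta_diff fun_eq_iff)
  next
    case (insert n F)
    then obtain g where g: "g \<in> A" "(\<lambda>m. \<Sum>n\<in>F. f n * (delta n m - delta 0 m)) = X g" by blast
    obtain h where h: "h \<in> A" "(\<lambda>m. delta n m - delta 0 m) = X h" using d by blast
    have "(\<Sum>n\<in>insert n F. f n * (delta n m - delta 0 m)) = X (\<lambda>m. f n * h m + g m) m" for m
      using insert fun_cong[OF g(2), of m] fun_cong[OF h(2), of m]
      by (simp add: convol_delta_diff) (simp add: algebra_simps)
    then show ?case using L1w_add(1)[OF L1w_scale(1)[OF h(1), of "f n"] g(1)] by blast
  qed
  \<comment> \<open>The total error is at most \<open>\<eta> + (\<eta> / c1) * w 0\<close>, from the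
    remainder and from \<open>s \<delta>_0\<close>; \<open>D\<close> collects the factor of
    \<open>\<eta>\<close>.\<close>
  define D where "D = 1 + w 0 / c1"
  have pos: "0 < D" using c1 w_nonneg[of 0] by (auto simp: D_def intro: add_pos_nonneg)
  define \<eta> where "\<eta> = e / (2 * D)"
  have \<eta>: "0 < \<eta>" using e pos by (simp add: \<eta>_def)
  obtain F where F: "finite F" "dist (\<Sum>n\<in>F. norm (f n) * w n) (nrm f) \<le> \<eta>"
    using infsum_finite_approximation[OF L1w_summable[OF fA] \<eta>] unfolding L1w_norm_def by blast
  define r where "r = (\<lambda>n. if n \<in> F then 0 else f n)"
  define s where "s = (\<Sum>n\<in>F. f n)"
  have r_le: "norm (r n) * w n \<le> norm (f n) * w n" for n
    by (simp add: r_def w_nonneg)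
  have rA: "r \<in> A"
    unfolding L1w_def mem_Collect_eq
    by (rule summable_on_comparison_test[OF L1w_summable[OF fA]]) (use r_le w_nonneg in auto)
  have "nrm r = (\<Sum>\<^sub>\<infinity>n\<in>UNIV - F. norm (f n) * w n)"
    unfolding L1w_norm_def by (rule infsum_cong_neutral) (auto simp: r_def)
  also have "\<dots> = nrm f - (\<Sum>n\<in>F. norm (f n) * w n)"
    unfolding L1w_norm_def
    by (subst infsum_Diff) (use F(1) L1w_summable[OF fA] in auto)
  also have "\<dots> \<le> \<eta>" using F(2) by (simp add: dist_real_def)
  finally have r: "nrm r \<le> \<eta>" .
  obtain g where g: "g \<in> A" "(\<lambda>m. \<Sum>n\<in>F. f n * (delta n m - delta 0 m)) = X g"
    using fin[OF F(1)] by blast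
  have Xg: "X g m = f m - r m - s * delta 0 m" for m
  proof -
    have "X g m = (\<Sum>n\<in>F. f n * delta n m) - s * delta 0 m"
      using fun_cong[OF g(2), of m] by (simp add: s_def right_diff_distrib sum_subtractf sum_distrib_right)
    also have "(\<Sum>n\<in>F. f n * delta n m) = f m - r m"
      using F(1) by (simp add: delta_def r_def if_distrib cong: if_cong)
    finally show ?thesis .
  qed
  have XgA: "X g \<in> A" using X_power_A[OF g(1), of 1] by simp
  \<comment> \<open>Both \<open>X g\<close> and \<open>f\<close> have sum 0, so \<open>s\<close> is
    minus the sum of the remainder \<open>r\<close> and hence at most
    \<open>nrm r / c1\<close>.\<close>
  have "fourier (X g) 0 = 0" using fourier_X_power[OF g(1), of 1 0] by simp
  then have "moment 0 (X g) = 0" by (simp add: moment_def)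
  moreover have "moment 0 (X g) = moment 0 f - moment 0 r - s"
  proof -
    have "X g = (\<lambda>m. (f m - r m) - s * delta 0 m)" using Xg by auto
    then show ?thesis
      by (simp add: moment_diff moment_scale L1w_diff L1w_scale L1w_delta fA rA moment_delta)
  qed
  moreover have "moment 0 f = 0" using f by (simp add: E_def)
  ultimately have "s = - moment 0 r" by simp
  then have "norm s = norm (moment 0 r)" by simp
  also have "\<dots> \<le> \<eta> / c1"
    using norm_moment_le[OF rA, of 0] r c1 by (simp add: order.trans[OF _ divide_right_mono])
  finally have s: "norm s \<le> \<eta> / c1" .
  have "nrm (\<lambda>n. f n - X g n) = nrm (\<lambda>n. r n + s * delta 0 n)"
    by (simp add: Xg algebra_simps)
  also have "\<dots> \<le> nrm r + norm s * w 0"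
    using L1w_add(2)[OF rA L1w_scale(1)[OF L1w_delta(1)]] by (simp add: L1w_scale(2)[OF L1w_delta(1)] L1w_delta(2))
  also have "\<dots> \<le> \<eta> + \<eta> / c1 * w 0"
    using r s w_nonneg by (intro add_mono mult_right_mono)
  also have "\<dots> = \<eta> * D" by (simp add: D_def algebra_simps)
  also have "\<dots> = e / 2" using pos by (simp add: \<eta>_def)
  also have "\<dots> < e" using e by simp
  finally show ?thesis using g(1) by blast
qed

text \<open>Given \<open>f\<close> close to \<open>x^m g\<close>, the function \<open>g\<close> is
  made divisible by \<open>x\<close> up to a small error. Its sum \<open>c\<close> is small, since
  \<open>m! c\<close> is the \<open>m\<close>-th moment of \<open>x^m g\<close> while that of
  \<open>f\<close> is 0; then \<open>g - c \<delta>_0\<close> lies in \<open>E 1\<close> and is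
  close to some \<open>x h\<close>.\<close>

lemma X_power_approx:
  assumes "m \<le> Suc N" "f \<in> E m" "0 < e"
  shows "\<exists>g\<in>A. nrm (\<lambda>n. f n - (X ^^ m) g n) < e"
  using assms
proof (induction m arbitrary: e)
  case 0
  then show ?case by (intro bexI[of _ f]) (auto simp: nrm_zero E_0)
next
  case (Suc m)
  have m: "m \<le> N" using Suc.prems by simp
  let ?d = "delta 0"
  define W where "W = nrm ((X ^^ m) ?d)"
  have xA: "(X ^^ m) ?d \<in> A" by (rule X_power_A[OF L1w_delta(1)])
  have W: "0 \<le> W" by (simp add: W_def nrm_nonneg)
  \<comment> \<open>The three errors are \<open>\<eta>\<close> from the induction hypothesis,
    \<open>|c| W \<le> \<eta> W / c1\<close> from the correction of \<open>g\<close>, and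
    \<open>W \<eta>\<close> from approximating by \<open>x h\<close>.\<close>
  define D where "D = 1 + W / c1 + W"
  have D: "0 < D" using W c1 by (simp add: D_def add_pos_nonneg)
  define \<eta> where "\<eta> = e / (2 * D)"
  have \<eta>: "0 < \<eta>" using Suc.prems D by (simp add: \<eta>_def)
  have fm: "f \<in> E m" using Suc.prems(2) E_antimono[of m "Suc m"] by auto
  have fA: "f \<in> A" by (rule E_subset[OF fm])
  obtain g where g: "g \<in> A" "nrm (\<lambda>n. f n - (X ^^ m) g n) < \<eta>"
    using Suc.IH[OF _ fm \<eta>] m by auto
  have XgA: "(X ^^ m) g \<in> A" by (rule X_power_A[OF g(1)])
  define c where "c = moment 0 g"
  have g1: "(\<lambda>n. g n - c * ?d n) \<in> E 1"
    using g(1) L1w_delta(1) by (simp add: E_def c_def L1w_diff L1w_scale moment_diff moment_scale moment_delta)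
  \<comment> \<open>The corrected product vanishes to order \<open>m + 1\<close>, so its
    \<open>m\<close>-th moment is 0; this evaluates the \<open>m\<close>-th moment of
    \<open>x^m g\<close>.\<close>
  have "(X ^^ m) (\<lambda>n. g n - c * ?d n) \<in> E (1 + m)"
    by (rule X_power_E[OF g1]) (use m in auto)
  then have "moment m (\<lambda>n. (X ^^ m) g n - c * (X ^^ m) ?d n) = 0"
    by (simp add: X_power_diff X_power_scale E_def)
  then have "moment m ((X ^^ m) g) = c * fact m"
    using m by (simp add: moment_diff moment_scale XgA xA L1w_scale moment_X_power_delta)
  moreover have "moment m (\<lambda>n. f n - (X ^^ m) g n) = - moment m ((X ^^ m) g)"
    using Suc.prems(2) m by (simp add: moment_diff fA XgA E_def)
  ultimately have "norm c * fact m \<le> nrm (\<lambda>n. f n - (X ^^ m) g n) / c1"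
    using norm_moment_le[OF L1w_diff(1)[OF fA XgA] m] by (simp add: norm_mult)
  also have "\<dots> \<le> \<eta> / c1" using g(2) c1 by (simp add: divide_right_mono)
  finally have c: "norm c \<le> \<eta> / c1"
    using mult_left_mono[of 1 "fact m" "norm c"] fact_ge_1[of m, where 'a = real] by simp
  obtain h where h: "h \<in> A" "nrm (\<lambda>n. (g n - c * ?d n) - X h n) < \<eta>"
    using delta_diff_approx[OF g1 \<eta>] by blast
  let ?r = "\<lambda>n. (g n - c * ?d n) - X h n"
  have XhA: "X h \<in> A" using X_power_A[OF h(1), of 1] by simp
  have rA: "?r \<in> A" by (intro L1w_diff L1w_scale L1w_delta g h XhA)
  have Xr: "nrm ((X ^^ m) ?r) \<le> W * \<eta>"
  proof -
    have "(X ^^ m) ?r = convol ((X ^^ m) ?d) ?r" by (rule X_power_delta_convol[OF rA, symmetric])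
    then have "nrm ((X ^^ m) ?r) \<le> W * nrm ?r"
      using L1w_convol(2)[OF xA rA] by (simp add: W_def)
    also have "\<dots> \<le> W * \<eta>" using h(2) W by (intro mult_left_mono) auto
    finally show ?thesis .
  qed
  have eq: "(\<lambda>n. f n - (X ^^ Suc m) h n) =
      (\<lambda>n. (f n - (X ^^ m) g n) + (c * (X ^^ m) ?d n + (X ^^ m) ?r n))"
    by (simp add: X_power_diff X_power_scale funpow_swap1 fun_eq_iff)
  have 1: "nrm (\<lambda>n. f n - (X ^^ Suc m) h n) \<le>
      nrm (\<lambda>n. f n - (X ^^ m) g n) + nrm (\<lambda>n. c * (X ^^ m) ?d n + (X ^^ m) ?r n)"
    unfolding eq by (intro L1w_add L1w_diff L1w_scale fA XgA xA X_power_A[OF rA])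
  have 2: "nrm (\<lambda>n. c * (X ^^ m) ?d n + (X ^^ m) ?r n) \<le> nrm (\<lambda>n. c * (X ^^ m) ?d n) + nrm ((X ^^ m) ?r)"
    by (intro L1w_add L1w_scale xA X_power_A[OF rA])
  have 3: "nrm (\<lambda>n. c * (X ^^ m) ?d n) = norm c * W"
    unfolding W_def by (rule L1w_scale(2)[OF xA])
  from 1 2 3 have "nrm (\<lambda>n. f n - (X ^^ Suc m) h n) \<le>
      nrm (\<lambda>n. f n - (X ^^ m) g n) + (norm c * W + nrm ((X ^^ m) ?r))"
    by linarith
  also have "nrm (\<lambda>n. f n - (X ^^ m) g n) + (norm c * W + nrm ((X ^^ m) ?r)) \<le> \<eta> + (\<eta> / c1 * W + W * \<eta>)"
    using g(2) c Xr W by (intro add_mono mult_right_mono) auto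
  also have "\<dots> = \<eta> * D" by (simp add: D_def algebra_simps)
  also have "\<dots> = e / 2" using D by (simp add: \<eta>_def)
  also have "\<dots> < e" using Suc.prems by simp
  finally show ?case using h(1) by blast
qed

end

section \<open>Points of the circle\<close>

lemma exp_eq_1_iff_rcong: "exp (- \<i> * of_real t) = 1 \<longleftrightarrow> [t = 0] (rmod (2 * pi))"
proof -
  have "exp (- \<i> * of_real t) = cis (- t)" by (simp add: cis_conv_exp)
  moreover have "cis (- t) = cis 0 \<longleftrightarrow> [t = 0] (rmod (2 * pi))"
    using rcong_uminus_uminus_iff[of t 0 "2 * pi"] by (simp only: cis_eq_iff minus_zero)
  ultimately show ?thesis by simp
qed

lemma zero_in_e_hat: "0 \<in> e_hat"
  by (simp add: e_hat_def circle_rel_def)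

lemma e_hat_in_circle: "e_hat \<in> circle"
  by (auto simp: e_hat_def circle_def quotient_def)

lemma circle_eq_e_hat:
  assumes "x \<in> circle" "t \<in> x" "[t = 0] (rmod (2 * pi))"
  shows "x = e_hat"
proof -
  obtain s where x: "x = circle_rel `` {s}" using assms(1) by (auto simp: circle_def quotient_def)
  then have "[s = t] (rmod (2 * pi))" using assms(2) by (simp add: circle_rel_def)
  then have "[s = 0] (rmod (2 * pi))" using assms(3) rcong_trans by blast
  then show ?thesis
    unfolding x e_hat_def circle_rel_def by (auto intro: rcong_trans rcong_sym)
qed

lemma circle_nonempty: "x \<in> circle \<Longrightarrow> \<exists>t. t \<in> x"
  by (auto simp: circle_def quotient_def circle_rel_def)

lemma fourier_e_hat:
  assumes "t \<in> e_hat"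
  shows "fourier f t = fourier f 0"
proof -
  have "[t = 0] (rmod (2 * pi))" using assms by (auto simp: e_hat_def circle_rel_def intro: rcong_sym)
  then obtain k where k: "0 = t + of_int k * (2 * pi)" by (auto simp: rcong_altdef)
  have "exp (- \<i> * of_int n * of_real t) = 1" for n
  proof -
    have "- \<i> * of_int n * of_real t = of_int (n * k) * (2 * of_real pi * \<i>)"
      using arg_cong[OF k, of "\<lambda>x. - \<i> * of_int n * complex_of_real x"] by (simp add: algebra_simps)
    then show ?thesis by (simp add: exp_eq_1) (metis of_int_mult)
  qed
  then show ?thesis by (simp add: fourier_def)
qed

section \<open>Closed primary ideals\<close>

context poly_beurling
begin

lemma moment_0: "moment 0 f = fourier f 0"
  by (simp add: moment_def)

text \<open>\<open>E 1\<close> has codimension one: any \<open>f\<close> outside it differs from a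
  nonzero multiple of \<open>delta 0\<close> by an element of \<open>E 1\<close>.\<close>

lemma E_1_maximalideal: "maximalideal (E 1) R"
proof (rule maximalidealI)
  show "ideal (E 1) R" by (rule E_ideal) simp
  have "delta 0 \<in> A" "delta 0 \<notin> E 1" by (auto simp: L1w_delta E_def moment_delta)
  then show "carrier R \<noteq> E 1" by (auto simp: ring_simps)
  fix K assume K: "ideal K R" "E 1 \<subseteq> K" "K \<subseteq> carrier R"
  show "K = E 1 \<or> K = carrier R"
  proof (cases "K \<subseteq> E 1")
    case False
    then obtain f where f: "f \<in> K" "f \<notin> E 1" by blast
    have fA: "f \<in> A" using f K ideal_subset by blast
    have c: "moment 0 f \<noteq> 0" using f fA by (auto simp: E_def)
    have "(\<lambda>n. f n - moment 0 f * delta 0 n) \<in> K"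
      using E_reduce[of f 0] fA K(2) by (auto simp: E_0)
    from ideal_diff[OF K(1) f(1) this] have "(\<lambda>n. moment 0 f * delta 0 n) \<in> K" by simp
    from ideal_scale[OF K(1) this, of "1 / moment 0 f"] have "delta 0 \<in> K" using c by simp
    then show ?thesis using ideal.one_imp_carrier[OF K(1)] by (simp add: ring_simps)
  qed (use K in blast)
qed

text \<open>A maximal ideal is prime, so \<open>x^m \<in> M\<close> gives \<open>x \<in> M\<close>
  and then every positive power of \<open>x\<close>. These allow a descent from
  \<open>E m \<subseteq> M\<close> to \<open>E 1 \<subseteq> M\<close>, and \<open>E 1\<close> is
  itself maximal.\<close>

lemma maximalideal_eq_E_1:
  assumes M: "maximalideal M R" and sub: "E m \<subseteq> M" and m: "1 \<le> m" "m \<le> Suc N"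
  shows "M = E 1"
proof -
  interpret M: maximalideal M R by fact
  have MI: "ideal M R" by (rule M.is_ideal)
  interpret P: primeideal M R using cring.maximalideal_prime[OF L1w_cring M] .
  have one: "delta 0 \<notin> M"
    using M.I_notcarr M.one_imp_carrier by (auto simp: ring_simps)
  have *: "delta_diff \<in> M" if "(X ^^ p) (delta 0) \<in> M" for p
    using that
  proof (induction p)
    case (Suc p)
    then have "delta_diff \<in> M \<or> (X ^^ p) (delta 0) \<in> M"
      using P.I_prime[of delta_diff "(X ^^ p) (delta 0)"]
      by (simp add: ring_simps delta_diff_A X_power_A L1w_delta)
    then show ?case using Suc.IH by blast
  qed (use one in simp)
  have "(X ^^ m) (delta 0) \<in> M" using X_power_delta_E m sub by blast
  then have d: "delta_diff \<in> M" by (rule *)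
  have x: "(X ^^ p) (delta 0) \<in> M" if p: "1 \<le> p" for p
  proof -
    obtain q where "p = Suc q" using p by (cases p) auto
    then have "(X ^^ p) (delta 0) = convol ((X ^^ q) (delta 0)) delta_diff"
      by (simp add: convol_commute delta_diff_A X_power_A L1w_delta)
    then show ?thesis using ideal_convol[OF MI d X_power_A[OF L1w_delta(1)]] by simp
  qed
  have "E 1 \<subseteq> M"
    using m(1) sub m(2)
  proof (induction rule: inc_induct)
    case (step p)
    show ?case
      by (rule E_subset_ideal_step[OF MI]) (use step x m in auto)
  qed auto
  then show ?thesis
    using maximalideal.I_maximal[OF E_1_maximalideal MI] M.I_notcarr M.a_subset by auto
qed

text \<open>The element \<open>x^m\<close> of \<open>E m\<close> already has no zero on the circle
  other than \<open>e_hat\<close>.\<close>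

lemma cospectrum_E:
  assumes m: "1 \<le> m" "m \<le> Suc N"
  shows "cospectrum (E m) = {e_hat}"
proof
  have "fourier f t = 0" if "f \<in> E m" "t \<in> e_hat" for f t
    using E_moment[OF that(1), of 0] m fourier_e_hat[OF that(2)] by (simp add: moment_0)
  then show "{e_hat} \<subseteq> cospectrum (E m)"
    by (auto simp: cospectrum_def e_hat_in_circle)
  show "cospectrum (E m) \<subseteq> {e_hat}"
  proof
    fix x assume x: "x \<in> cospectrum (E m)"
    then have xc: "x \<in> circle" by (simp add: cospectrum_def)
    then obtain t where t: "t \<in> x" using circle_nonempty by blast
    have "fourier ((X ^^ m) (delta 0)) t = 0"
      using x t X_power_delta_E[OF m(2)] by (auto simp: cospectrum_def)
    then have "exp (- \<i> * of_real t) = 1"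
      using fourier_X_power[OF L1w_delta(1), of m 0 t] by (simp add: fourier_delta)
    then show "x \<in> {e_hat}" using circle_eq_e_hat[OF xc t] exp_eq_1_iff_rcong by simp
  qed
qed

lemma E_primary:
  assumes m: "1 \<le> m" "m \<le> Suc N"
  shows "primary_ideal (E m) R"
  unfolding primary_ideal_def
proof (intro conjI ex1I[of _ "E 1"])
  show "ideal (E m) R" by (rule E_ideal[OF m(2)])
  show "maximalideal (E 1) R" by (rule E_1_maximalideal)
  show "E m \<subseteq> E 1" by (rule E_antimono[OF m(1)])
  show "M = E 1" if "maximalideal M R \<and> E m \<subseteq> M" for M
    using maximalideal_eq_E_1[of M m] that m by blast
qed

text \<open>
  Among the elements of \<open>J\<close> are those whose Fourier transform vanishes near \<open>0\<close>; the kernels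
  show that \<open>delta_diff\<close> to the power \<open>N + 1\<close> is a limit of such elements because
  \<open>\<alpha> < 1\<close>.
\<close>

lemma X_power_Suc_N_in_ideal:
  assumes J: "ideal J R" and max: "\<And>M. maximalideal M R \<Longrightarrow> J \<subseteq> M \<Longrightarrow> M = E 1"
    and closed: "closedin (L1w_topology w) J"
  shows "(X ^^ Suc N) (delta 0) \<in> J"
proof -
  define K where "K = N + 3"
  have bd: "0 \<le> real N + \<alpha>" "real N + \<alpha> \<le> real N + 1" using \<alpha> by auto
  obtain C0 where k0: "\<And>L. 1 \<le> L \<Longrightarrow> (X ^^ 0) (bump_kernel K L) \<in> A"
    by (rule delta_diff_power_kernel_norm[of w c2 "real N + \<alpha>" N K 0])
       (use w_nonneg w_upper bd c2 in \<open>auto simp: K_def\<close>)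
  then have kA: "bump_kernel K L \<in> A" if "1 \<le> L" for L using that by simp
  obtain C where C: "\<And>L. 1 \<le> L \<Longrightarrow>
      nrm ((X ^^ Suc N) (bump_kernel K L)) \<le> C * L powr (real N + \<alpha> - real (Suc N))"
    by (rule delta_diff_power_kernel_norm[of w c2 "real N + \<alpha>" N K "Suc N"])
       (use w_nonneg w_upper bd c2 in \<open>auto simp: K_def\<close>)
  have xA: "(X ^^ Suc N) (delta 0) \<in> A" by (rule X_power_A[OF L1w_delta(1)])
  have "\<exists>g\<in>J. nrm (\<lambda>n. (X ^^ Suc N) (delta 0) n - g n) < e" if e: "0 < e" for e
  proof -
    \<comment> \<open>The exponent \<open>N + \<alpha> - (N + 1)\<close> is
      \<open>- (1 - \<alpha>)\<close>, negative because \<open>\<alpha> < 1\<close>.\<close>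
    have "((\<lambda>L. C * L powr (- (1 - \<alpha>))) \<longlongrightarrow> C * 0) at_top"
      by (intro tendsto_mult tendsto_const tendsto_neg_powr filterlim_ident) (use \<alpha> in auto)
    then have "eventually (\<lambda>L. C * L powr (- (1 - \<alpha>)) < e \<and> 1 \<le> L) at_top"
      using e by (intro eventually_conj order_tendstoD(2)[of _ "C * 0"] eventually_ge_at_top) auto
    then obtain L where L: "C * L powr (- (1 - \<alpha>)) < e" "1 \<le> L"
      using eventually_happens trivial_limit_at_top_linorder by blast
    define f where "f = (\<lambda>n. delta 0 n - bump_kernel K L n)"
    have fA: "f \<in> A" unfolding f_def by (intro L1w_diff L1w_delta kA L)
    have f0: "fourier f t = 0" if "\<bar>t\<bar> < 1 / L" for t
      using fourier_bump_kernel_eq_1[OF L(2) _ L1w_l1[OF kA[OF L(2)]] that]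
        fourier_diff_L1w[OF L1w_delta(1) kA[OF L(2)], of 0 t]
      by (simp add: f_def fourier_delta K_def)
    \<comment> \<open>The second kernel is the \<open>h\<close> of the unit-ideal argument: its
      transform is 1 at 0, which puts it outside \<open>E 1\<close>, and lives where the transform
      of \<open>f\<close> vanishes.\<close>
    have hA: "bump_kernel K (3 * L) \<in> A" by (rule kA) (use L in simp)
    have h0: "fourier (bump_kernel K (3 * L)) 0 = 1"
      by (rule fourier_bump_kernel_eq_1) (use L L1w_l1[OF hA] in \<open>auto simp: K_def\<close>)
    have fh: "convol f (bump_kernel K (3 * L)) = (\<lambda>_. 0)"
      by (rule convol_bump_kernel_eq_0[OF L1w_l1[OF fA] L(2) f0])
    have "bump_kernel K (3 * L) \<notin> E 1" using h0 by (simp add: E_def moment_0)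
    then have "f \<in> J"
      using in_ideal_of_convol_eq_0[OF J _ hA fA fh] max by blast
    then have "convol ((X ^^ Suc N) (delta 0)) f \<in> J" using ideal_convol[OF J _ xA] by blast
    then have gJ: "(X ^^ Suc N) f \<in> J" unfolding X_power_delta_convol[OF fA] .
    have "(\<lambda>n. (X ^^ Suc N) (delta 0) n - (X ^^ Suc N) f n) = (X ^^ Suc N) (bump_kernel K L)"
      unfolding X_power_diff[symmetric] by (simp add: f_def)
    moreover have "nrm ((X ^^ Suc N) (bump_kernel K L)) < e"
      using C[OF L(2)] L(1) by (simp add: algebra_simps)
    ultimately show ?thesis by (intro bexI[OF _ gJ]) (simp only:)
  qed
  then show ?thesis using closed xA unfolding closedin_L1w_iff by blast
qed

lemma closed_primary_eq_E:
  assumes prim: "primary_ideal J R" and closed: "closedin (L1w_topology w) J"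
    and cosp: "cospectrum J = {e_hat}"
  shows "\<exists>m. 1 \<le> m \<and> m \<le> Suc N \<and> J = E m"
proof -
  have J: "ideal J R" using prim by (simp add: primary_ideal_def)
  have J1: "J \<subseteq> E 1"
  proof
    fix f assume f: "f \<in> J"
    then have "fourier f 0 = 0" using cosp zero_in_e_hat by (auto simp: cospectrum_def)
    then show "f \<in> E 1" using ideal_subset[OF J f] by (simp add: E_def moment_0)
  qed
  have max: "M = E 1" if "maximalideal M R" "J \<subseteq> M" for M
    using prim J1 E_1_maximalideal that unfolding primary_ideal_def by blast
  have x: "(X ^^ Suc N) (delta 0) \<in> J"
    by (rule X_power_Suc_N_in_ideal[OF J max closed])
  have EN: "E (Suc N) \<subseteq> J"
  proof
    fix f assume f: "f \<in> E (Suc N)"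
    have "\<exists>g\<in>J. nrm (\<lambda>n. f n - g n) < e" if e: "0 < e" for e
    proof -
      obtain g where g: "g \<in> A" "nrm (\<lambda>n. f n - (X ^^ Suc N) g n) < e"
        using X_power_approx[OF _ f e] by auto
      have "convol g ((X ^^ Suc N) (delta 0)) \<in> J" by (rule ideal_convol[OF J x g(1)])
      then have "(X ^^ Suc N) g \<in> J"
        using X_power_delta_convol[OF g(1), of "Suc N"] convol_commute[OF X_power_A[OF L1w_delta(1)] g(1)] by metis
      then show ?thesis using g(2) by blast
    qed
    then show "f \<in> J" using closed E_subset[OF f] unfolding closedin_L1w_iff by blast
  qed
  \<comment> \<open>The largest order to which all of \<open>J\<close> vanishes; if
    \<open>k \<le> N\<close>, some element of \<open>J\<close> has a nonzero \<open>k\<close>-th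
    moment.\<close>
  define k where "k = (GREATEST m. m \<le> Suc N \<and> J \<subseteq> E m)"
  have k: "k \<le> Suc N" "J \<subseteq> E k"
    using GreatestI_nat[of "\<lambda>m. m \<le> Suc N \<and> J \<subseteq> E m" 1 "Suc N"] J1 by (auto simp: k_def)
  have k_max: "m \<le> k" if "m \<le> Suc N" "J \<subseteq> E m" for m
    using Greatest_le_nat[of "\<lambda>m. m \<le> Suc N \<and> J \<subseteq> E m" m "Suc N"] that by (auto simp: k_def)
  have k1: "1 \<le> k" using k_max[of 1] J1 by simp
  have "E k \<subseteq> J"
  proof (cases "k = Suc N")
    case False
    then have kN: "k \<le> N" using k by simp
    then have "\<not> J \<subseteq> E (Suc k)" using k_max[of "Suc k"] by auto
    then obtain f where f: "f \<in> J" "f \<notin> E (Suc k)" by blast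
    have fk: "f \<in> E k" using f k by blast
    define c where "c = moment k f / fact k"
    define r where "r = (\<lambda>n. f n - c * (X ^^ k) (delta 0) n)"
    have r: "r \<in> E (Suc k)" unfolding r_def c_def by (rule E_reduce[OF fk kN])
    have "moment k f \<noteq> 0" using f fk by (auto simp: E_def less_Suc_eq)
    then have c: "c \<noteq> 0" by (simp add: c_def)
    show ?thesis
      using k(1) EN
    proof (induction rule: inc_induct)
      case (step p)
      have pN: "p \<le> N" using step by simp
      \<comment> \<open>From \<open>f = c x^k + r\<close> follows
        \<open>c x^p = x^(p - k) f - x^(p - k) r\<close>. The last product lies in
        \<open>E (Suc p)\<close>, which is inside \<open>J\<close> by the induction descending from
        \<open>Suc N\<close>.\<close>
      have "(X ^^ p) (delta 0) \<in> J"
      proof -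
        have fA: "f \<in> A" and rA: "r \<in> A" using fk r E_subset by auto
        have "convol ((X ^^ (p - k)) (delta 0)) f \<in> J"
          by (rule ideal_convol[OF J f(1) X_power_A[OF L1w_delta(1)]])
        then have 1: "(X ^^ (p - k)) f \<in> J" unfolding X_power_delta_convol[OF fA] .
        have "(X ^^ (p - k)) r \<in> E (Suc k + (p - k))"
          by (rule X_power_E[OF r]) (use step pN in auto)
        then have 2: "(X ^^ (p - k)) r \<in> J" using step by auto
        have "(X ^^ (p - k)) r = (\<lambda>n. (X ^^ (p - k)) f n - c * (X ^^ (p - k + k)) (delta 0) n)"
          unfolding r_def X_power_diff X_power_scale by (simp add: funpow_add)
        then have "(\<lambda>n. (X ^^ (p - k)) f n - (X ^^ (p - k)) r n) = (\<lambda>n. c * (X ^^ p) (delta 0) n)"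
          using step by simp
        then have "(\<lambda>n. c * (X ^^ p) (delta 0) n) \<in> J" using ideal_diff[OF J 1 2] by simp
        from ideal_scale[OF J this, of "1 / c"] show ?thesis using c by simp
      qed
      then show ?case by (intro E_subset_ideal_step[OF J pN]) (use step in auto)
    qed auto
  qed (use EN in simp)
  then show ?thesis using k k1 by blast
qed

end

theorem theorem4p1:
  fixes N :: nat and w :: "int \<Rightarrow> real"
  assumes "weight w"
    and "\<exists>c1 c2 \<alpha> :: real. 0 < c1 \<and> 0 < c2 \<and> 0 < \<alpha> \<and> \<alpha> < 1 \<and>
      (\<forall>m. c1 * (1 + of_int \<bar>m\<bar> ^ N) \<le> w m \<and>
           w m \<le> c2 * (1 + of_int \<bar>m\<bar> powr (of_nat N + \<alpha>)))"
  shows "{J. primary_ideal J (L1w_ring w) \<and> closedin (L1w_topology w) J \<and>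
             cospectrum J = {e_hat}}
         = {I_ideal w k | k. k \<le> N}"
proof -
  obtain c1 c2 \<alpha> where "poly_beurling w N c1 c2 \<alpha>"
    using assms by (auto simp: poly_beurling_def poly_beurling_axioms_def beurling_def)
  then interpret poly_beurling w N c1 c2 \<alpha> .
  show ?thesis
  proof (intro subset_antisym subsetI)
    fix J assume "J \<in> {J. primary_ideal J R \<and> closedin (L1w_topology w) J \<and> cospectrum J = {e_hat}}"
    then obtain m where m: "1 \<le> m" "m \<le> Suc N" "J = E m" using closed_primary_eq_E by blast
    then obtain k where "m = Suc k" by (cases m) auto
    then show "J \<in> {I_ideal w k | k. k \<le> N}" using m I_ideal_eq[of k] by auto
  next
    fix J assume "J \<in> {I_ideal w k | k. k \<le> N}"
    then obtain k where "k \<le> N" "J = E (Suc k)" using I_ideal_eq by auto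
    then show "J \<in> {J. primary_ideal J R \<and> closedin (L1w_topology w) J \<and> cospectrum J = {e_hat}}"
      using E_primary[of "Suc k"] E_closedin[of "Suc k"] cospectrum_E[of "Suc k"] by simp
  qed
qed

end
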